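(* Let $u,\gamma>0$ and let $V\in\mathcal{C}^2(\mathbb{R}^d)$ be of the form $V(x)=\tfrac12 x\cdot(Kx)+G(x)$, where $K\in\mathbb{R}^{d\times d}$ is a (symmetric) positive definite matrix with smallest eigenvalue $\kappa>0$ and largest eigenvalue $L_K$, and $G:\mathbb{R}^d\to\mathbb{R}$ is convex with $L_G$-Lipschitz continuous gradient, i.e. $\langle\nabla G(x)-\nabla G(\bar x),x-\bar x\rangle\ge 0$ and $|\nabla G(x)-\nabla G(\bar x)|\le L_G|x-\bar x|$ for all $x,\bar x\in\mathbb{R}^d$. Suppose $$L_G\,u\,\gamma^{-2}\le 3/4 .$$ For $t\ge0$ let $\mu_t$ and $\nu_t$ be the laws at time $t$ of $(X_t,Y_t)$ and $(X'_t,Y'_t)$, respectively, where $(X_s,Y_s)_{s\ge0}$ and $(X_s',Y_s')_{s\ge0}$ are solutions of the Langevin equation $$\mathrm{d}X_t=Y_t\,\mathrm{d}t,\qquad \mathrm{d}Y_t=(-\gamma Y_t-u\nabla V(X_t))\,\mathrm{d}t+\sqrt{2\gamma u}\,\mathrm{d}B_t$$ ($B$ a $d$-dimensional standard Brownian motion) with initial distributions $\mu_0$ and $\nu_0$ on $\mathbb{R}^{2d}$, respectively. Then for any $1\le p<\infty$ and all $t\ge 0$, $$\mathcal{W}_{p,r}(\mu_t,\nu_t)\le e^{-ct}\,\mathcal{W}_{p,r}(\mu_0,\nu_0)\qquad\text{and}\qquad \mathcal{W}_p(\mu_t,\nu_t)\le M e^{-ct}\,\mathcal{W}_p(\mu_0,\nu_0),$$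 where $r$ is the distance defined in the context, $$c=\gamma\lambda=\min\big(\gamma/8,\ \kappa u\gamma^{-1}/2\big),\qquad M=\sqrt{\max(uL_K+\gamma^2,\,3/2)\,\max(1/(u\kappa),\,2)} .$$
   Context: $|\cdot|$ is the Euclidean norm. For probability measures $\mu,\nu$ on a space $\mathbb{X}$ and a distance function $d$ on $\mathbb{X}$, $\mathcal{W}_{p,d}(\mu,\nu)=\inf_{\omega}\big(\int d(x,y)^p\,\omega(\mathrm{d}x\,\mathrm{d}y)\big)^{1/p}$, the infimum being over all couplings $\omega$ of $\mu$ and $\nu$; $\mathcal{W}_p$ is $\mathcal{W}_{p,d}$ with $d$ the Euclidean distance. The constant $\lambda$ is $\lambda=\min(1/8,\ \kappa u\gamma^{-2}/2)$, and the distance $r:\mathbb{R}^{2d}\times\mathbb{R}^{2d}\to[0,\infty)$ is given by $$r((x,y),(\bar x,\bar y))^2=\gamma^{-2}u\,(x-\bar x)\cdot(K(x-\bar x))+\tfrac12\big|(1-2\lambda)(x-\bar x)+\gamma^{-1}(y-\bar y)\big|^2+\tfrac12\gamma^{-2}|y-\bar y|^2 .$$ *)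

theory Defs
  imports "HOL-Probability.Probability"
begin

section \<open>Calculus and linear algebra\<close>

definition grad :: "('a::euclidean_space \<Rightarrow> real) \<Rightarrow> 'a \<Rightarrow> 'a" where
  "grad f x = (THE D. GDERIV f x :> D)"

lemma grad_eq: "GDERIV f x :> D \<Longrightarrow> grad f x = D"
  unfolding grad_def
proof (rule the_equality)
  fix D' assume "GDERIV f x :> D" "GDERIV f x :> D'"
  then have "(\<lambda>h. inner h D) = (\<lambda>h. inner h D')"
    unfolding gderiv_def by (rule has_derivative_unique)
  then show "D' = D" by (metis vector_eq_ldot inner_commute)
qed

text \<open>Twice continuously differentiable on the whole space, in the sense of Frechet derivatives.\<close>

definition C2 :: "('a::euclidean_space \<Rightarrow> real) \<Rightarrow> bool" where
  "C2 f \<longleftrightarrow> (\<exists>(f' :: 'a \<Rightarrow> 'a \<Rightarrow>\<^sub>L real) (f'' :: 'a \<Rightarrow> 'a \<Rightarrow>\<^sub>L 'a \<Rightarrow>\<^sub>L real).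
     (\<forall>x. (f has_derivative blinfun_apply (f' x)) (at x)) \<and>
     (\<forall>x. (f' has_derivative blinfun_apply (f'' x)) (at x)) \<and>
     continuous_on UNIV f'')"

lemma C2_grad:
  assumes "C2 f" shows "GDERIV f x :> grad f x"
proof -
  from assms obtain f' :: "'a \<Rightarrow> 'a \<Rightarrow>\<^sub>L real"
    where d: "(f has_derivative blinfun_apply (f' x)) (at x)"
    unfolding C2_def by blast
  define D where "D = (\<Sum>b\<in>Basis. f' x b *\<^sub>R b)"
  have "blinfun_apply (f' x) h = inner h D" for h
  proof -
    have "f' x h = f' x (\<Sum>b\<in>Basis. inner h b *\<^sub>R b)"
      by (simp add: euclidean_representation)
    also have "\<dots> = inner h D"
      by (simp add: D_def blinfun.sum_right blinfun.scaleR_right inner_sum_right mult.commute)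
    finally show ?thesis .
  qed
  then have "blinfun_apply (f' x) = (\<lambda>h. inner h D)" by auto
  with d have "GDERIV f x :> D" by (simp add: gderiv_def)
  with grad_eq[OF this] show ?thesis by simp
qed

definition positive_definite :: "real ^ 'd ^ 'd \<Rightarrow> bool" where
  "positive_definite K \<longleftrightarrow> transpose K = K \<and> (\<forall>x. x \<noteq> 0 \<longrightarrow> x \<bullet> (K *v x) > 0)"

definition eigenvalues :: "real ^ 'd ^ 'd \<Rightarrow> real set" where
  "eigenvalues K = {a. \<exists>v. v \<noteq> 0 \<and> K *v v = a *\<^sub>R v}"


section \<open>Wasserstein distances\<close>

definition couplings :: "'a measure \<Rightarrow> 'a measure \<Rightarrow> ('a \<times> 'a) measure set" where
  "couplings \<mu> \<nu> = {\<omega>. sets \<omega> = sets (\<mu> \<Otimes>\<^sub>M \<nu>) \<and> distr \<omega> \<mu> fst = \<mu> \<and> distr \<omega> \<nu> snd = \<nu>}"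

definition ennreal_powr :: "ennreal \<Rightarrow> real \<Rightarrow> ennreal" where
  "ennreal_powr x a = (if x = \<infinity> then \<infinity> else ennreal (enn2real x powr a))"
  \<comment> \<open>meant for \<open>a > 0\<close>\<close>

text \<open>The value is \<open>\<infinity>\<close> if every coupling has infinite cost; the marginals are not
  assumed to have finite \<open>p\<close>-th moments.\<close>

definition wasserstein :: "real \<Rightarrow> ('a \<Rightarrow> 'a \<Rightarrow> real) \<Rightarrow> 'a measure \<Rightarrow> 'a measure \<Rightarrow> ennreal" where
  "wasserstein p d \<mu> \<nu> =
     (INF \<omega>\<in>couplings \<mu> \<nu>. ennreal_powr (\<integral>\<^sup>+ z. ennreal (d (fst z) (snd z) powr p) \<partial>\<omega>) (1 / p))"


section \<open>Brownian motion and the Langevin equation\<close>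

text \<open>Processes are indexed by the reals; only times \<open>t \<ge> 0\<close> matter. The increment over
  \<open>[s, t]\<close> has the density of a centred Gaussian vector with covariance \<open>(t - s)\<close> times the
  identity.\<close>

definition brownian_motion ::
  "'w measure \<Rightarrow> (real \<Rightarrow> 'w measure) \<Rightarrow> (real \<Rightarrow> 'w \<Rightarrow> real ^ 'd) \<Rightarrow> bool" where
  "brownian_motion M F B \<longleftrightarrow>
     prob_space M \<and>
     filtration (space M) F \<and>
     (\<forall>t\<ge>0. sets (F t) \<subseteq> sets M) \<and>
     (\<forall>t\<ge>0. B t \<in> borel_measurable (F t)) \<and>
     (AE w in M. B 0 w = 0) \<and>
     (AE w in M. continuous_on {0..} (\<lambda>t. B t w)) \<and>
     (\<forall>s t. 0 \<le> s \<and> s < t \<longrightarrow>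
        prob_space.indep_set M (sets (F s))
          (sets (vimage_algebra (space M) (\<lambda>w. B t w - B s w) borel)) \<and>
        distributed M lborel (\<lambda>w. B t w - B s w)
          (\<lambda>x. ennreal (\<Prod>i\<in>UNIV. normal_density 0 (sqrt (t - s)) (x $ i))))"

text \<open>The noise is additive, so the stochastic differential equation is the pathwise integral
  equation below. A solution is adapted to the filtration, with respect to which \<open>B\<close> is
  a Brownian motion; in particular the initial value is independent of \<open>B\<close>.\<close>

definition langevin_solution ::
  "real \<Rightarrow> real \<Rightarrow> (real ^ 'd \<Rightarrow> real) \<Rightarrow> 'w measure \<Rightarrow> (real \<Rightarrow> 'w measure) \<Rightarrow>
   (real \<Rightarrow> 'w \<Rightarrow> real ^ 'd) \<Rightarrow> (real \<Rightarrow> 'w \<Rightarrow> real ^ 'd) \<Rightarrow> (real \<Rightarrow> 'w \<Rightarrow> real ^ 'd) \<Rightarrow> bool" where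
  "langevin_solution u \<gamma> V M F B X Y \<longleftrightarrow>
     brownian_motion M F B \<and>
     (\<forall>t\<ge>0. X t \<in> borel_measurable (F t) \<and> Y t \<in> borel_measurable (F t)) \<and>
     (AE w in M. continuous_on {0..} (\<lambda>t. X t w) \<and> continuous_on {0..} (\<lambda>t. Y t w)) \<and>
     (AE w in M. \<forall>t\<ge>0.
        X t w = X 0 w + integral {0..t} (\<lambda>s. Y s w) \<and>
        Y t w = Y 0 w + integral {0..t} (\<lambda>s. - \<gamma> *\<^sub>R Y s w - u *\<^sub>R grad V (X s w))
                  + sqrt (2 * \<gamma> * u) *\<^sub>R B t w)"

definition joint_law ::
  "'w measure \<Rightarrow> ('w \<Rightarrow> real ^ 'd) \<Rightarrow> ('w \<Rightarrow> real ^ 'd) \<Rightarrow> ((real ^ 'd) \<times> (real ^ 'd)) measure" where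
  "joint_law M X Y = distr M borel (\<lambda>w. (X w, Y w))"


section \<open>The twisted distance\<close>

definition langevin_lambda :: "real \<Rightarrow> real \<Rightarrow> real \<Rightarrow> real" where
  "langevin_lambda u \<gamma> \<kappa> = min (1 / 8) (\<kappa> * u / \<gamma>\<^sup>2 / 2)"

definition langevin_dist ::
  "real \<Rightarrow> real \<Rightarrow> real \<Rightarrow> real ^ 'd ^ 'd \<Rightarrow>
   (real ^ 'd) \<times> (real ^ 'd) \<Rightarrow> (real ^ 'd) \<times> (real ^ 'd) \<Rightarrow> real" where
  "langevin_dist u \<gamma> \<kappa> K z z' =
     (let x = fst z - fst z'; y = snd z - snd z'; l = langevin_lambda u \<gamma> \<kappa> in
        sqrt (u / \<gamma>\<^sup>2 * (x \<bullet> (K *v x))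
              + 1 / 2 * (norm ((1 - 2 * l) *\<^sub>R x + (1 / \<gamma>) *\<^sub>R y))\<^sup>2
              + 1 / 2 * (1 / \<gamma>\<^sup>2) * (norm y)\<^sup>2))"

end

theory Submission
  imports Defs
begin

text \<open>
  Driven by the same noise, two Euler schemes differ by a noise-free recursion, and with \<open>Q\<close> the
  quadratic form of the twisted distance, one step of size \<open>h\<close> multiplies \<open>Q\<close> of the difference
  by at most \<open>1 - 2 c h + O(h\<^sup>2)\<close>; here the convex part \<open>G\<close> enters through the cocoercivity of its
  gradient. For a continuous noise path the schemes converge for every initial value, so the limit
  \<open>\<Phi>(z, w)\<close> is a measurable flow that contracts by \<open>exp (- c t)\<close>, and no existence theorem for the
  equation is needed. An initial coupling \<open>\<omega>\<close> is transported by applying \<open>\<Phi>(\<cdot>, w)\<close> to both components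
  under \<open>\<omega> \<otimes> M\<close>. The marginals are the given laws because the law of an Euler scheme is an iterate
  of a transition operator that depends only on the initial law and the Gaussian increments, and both
  solutions are almost sure limits of Euler schemes.
\<close>

section \<open>Eigenvalue bounds for quadratic forms\<close>

text \<open>The two solutions may live on different probability spaces with unrelated Brownian
  motions, and a coupling of the initial laws need not be realised on either of them. Hence the
  solutions cannot be subtracted from each other; both have to be rebuilt from one common noise. The
  rebuilt process must be measurable in starting point and noise jointly, which a limit of explicit
  schemes gives at once. Convergence fails at most on the null set of discontinuous paths, and this
  set does not depend on the starting point. The contraction holds path by path, before any
  integration, so all exponents \<open>p\<close> are treated alike. As for the constants: \<lambda>
  \<le> 1/8 makes the weight 1 - 2 \<lambda> at least 3/4, which is exactly what the smallness
  condition on \<open>L_G\<close> is compared with. The prefactor of the Euclidean estimate is the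
  square root of the product of the two constants that compare \<open>\<gamma>\<^sup>2 * Q\<close>
  with the squared Euclidean norm from above and from below.\<close>

lemma inner_matrix_commute:
  fixes K :: "real ^ 'n ^ 'n"
  assumes "transpose K = K"
  shows "x \<bullet> (K *v y) = y \<bullet> (K *v x)"
  by (metis assms dot_lmul_matrix inner_commute vector_transpose_matrix)

lemma quadratic_form_add_scaleR:
  fixes K :: "real ^ 'n ^ 'n"
  assumes "transpose K = K"
  shows "(v + s *\<^sub>R h) \<bullet> (K *v (v + s *\<^sub>R h)) = v \<bullet> (K *v v) + 2 * s * (h \<bullet> (K *v v)) + s\<^sup>2 * (h \<bullet> (K *v h))"
proof -
  have "v \<bullet> (K *v h) = h \<bullet> (K *v v)" by (rule inner_matrix_commute[OF assms])
  then show ?thesis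
    by (simp add: matrix_vector_right_distrib matrix_vector_mult_scaleR inner_add_left
        inner_add_right power2_eq_square algebra_simps)
qed

text \<open>A minimiser of the quadratic form on the unit sphere is an eigenvector, as the shifted form
  is nonnegative and vanishes there.\<close>

lemma eigenvalue_lower_bound:
  fixes K :: "real ^ 'n ^ 'n"
  assumes sym: "transpose K = K" and le: "\<And>a. a \<in> eigenvalues K \<Longrightarrow> l \<le> a"
  shows "l * (norm x)\<^sup>2 \<le> x \<bullet> (K *v x)"
proof -
  have "continuous_on (sphere 0 1) (\<lambda>x. x \<bullet> (K *v x))"
    by (intro continuous_intros linear_continuous_on matrix_vector_mul_bounded_linear)
  moreover have "sphere 0 1 \<noteq> ({} :: (real ^ 'n) set)" by simp
  ultimately obtain v where v: "norm v = 1"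
    and min: "\<And>y. norm y = 1 \<Longrightarrow> v \<bullet> (K *v v) \<le> y \<bullet> (K *v y)"
    using continuous_attains_inf[of "sphere 0 1" "\<lambda>x. x \<bullet> (K *v x)"] by auto
  define m where "m = v \<bullet> (K *v v)"
  have Q: "m * (norm y)\<^sup>2 \<le> y \<bullet> (K *v y)" for y
  proof (cases "y = 0")
    case False
    have "m \<le> (y /\<^sub>R norm y) \<bullet> (K *v (y /\<^sub>R norm y))"
      unfolding m_def using False by (intro min) simp
    also have "\<dots> = (y \<bullet> (K *v y)) / (norm y)\<^sup>2"
      by (simp add: matrix_vector_mult_scaleR power2_eq_square divide_simps)
    finally show ?thesis using False by (simp add: field_simps)
  qed simp
  \<comment> \<open>Half the gradient at \<open>v\<close> of the shifted form
    \<open>y \<bullet> (K *v y) - m * (norm y)\<^sup>2\<close>.\<close>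
  define h where "h = K *v v - m *\<^sub>R v"
  have "0 \<le> 2 * s * (norm h)\<^sup>2 + s\<^sup>2 * (h \<bullet> (K *v h) - m * (norm h)\<^sup>2)" for s
  proof -
    have n: "(norm (v + s *\<^sub>R h))\<^sup>2 = 1 + 2 * s * (h \<bullet> v) + s\<^sup>2 * (norm h)\<^sup>2"
      using v unfolding power2_norm_eq_inner
      by (simp add: inner_add_left inner_add_right power2_eq_square inner_commute algebra_simps norm_eq_1)
    have "m * (norm (v + s *\<^sub>R h))\<^sup>2 \<le> (v + s *\<^sub>R h) \<bullet> (K *v (v + s *\<^sub>R h))" by (rule Q)
    then have "0 \<le> 2 * s * (h \<bullet> (K *v v) - m * (h \<bullet> v)) + s\<^sup>2 * (h \<bullet> (K *v h) - m * (norm h)\<^sup>2)"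
      unfolding n quadratic_form_add_scaleR[OF sym] by (simp add: m_def algebra_simps)
    moreover have "h \<bullet> (K *v v) - m * (h \<bullet> v) = (norm h)\<^sup>2"
      unfolding power2_norm_eq_inner by (simp add: h_def inner_diff_right)
    ultimately show ?thesis by simp
  qed
  note ineq = this
  have "h = 0"
  proof (rule ccontr)
    assume "h \<noteq> 0"
    define N where "N = (norm h)\<^sup>2"
    define R where "R = h \<bullet> (K *v h) - m * (norm h)\<^sup>2"
    have N: "N > 0" using \<open>h \<noteq> 0\<close> by (simp add: N_def)
    have R: "R \<ge> 0" using Q[of h] by (simp add: R_def)
    \<comment> \<open>For small negative \<open>s\<close> the linear term wins. The choice
      \<open>s = - N / (R + 1)\<close> is small enough, and the summand 1 keeps the denominator
      positive when \<open>R = 0\<close>.\<close>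
    have "0 \<le> 2 * (- N / (R + 1)) * N + (- N / (R + 1))\<^sup>2 * R"
      using ineq[of "- N / (R + 1)"] by (simp add: N_def R_def)
    also have "\<dots> = (N / (R + 1))\<^sup>2 * (- R - 2)"
      using R by (simp add: power2_eq_square divide_simps) (simp add: algebra_simps)
    also have "\<dots> < 0" using N R by (simp add: mult_pos_neg)
    finally show False by simp
  qed
  then have "m \<in> eigenvalues K"
    using v unfolding eigenvalues_def h_def by (intro CollectI exI[of _ v]) auto
  then have "l * (norm x)\<^sup>2 \<le> m * (norm x)\<^sup>2" by (intro mult_right_mono le) auto
  then show ?thesis using Q[of x] by linarith
qed

text \<open>The eigenvalues of \<open>- K\<close> are the negatives of those of \<open>K\<close>, so
  the lower bound applies to \<open>- K\<close>.\<close>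

lemma eigenvalue_upper_bound:
  fixes K :: "real ^ 'n ^ 'n"
  assumes sym: "transpose K = K" and le: "\<And>a. a \<in> eigenvalues K \<Longrightarrow> a \<le> l"
  shows "x \<bullet> (K *v x) \<le> l * (norm x)\<^sup>2"
proof -
  have neg: "(- K) *v v = - (K *v v)" for v
    by (simp add: matrix_vector_mult_def vec_eq_iff sum_negf)
  have "transpose (- K) = - K" using sym by (simp add: transpose_def vec_eq_iff)
  moreover have "- l \<le> a" if "a \<in> eigenvalues (- K)" for a
  proof -
    from that obtain v where "v \<noteq> 0" "- (K *v v) = a *\<^sub>R v" by (auto simp: eigenvalues_def neg)
    then have "- a \<in> eigenvalues K"
      unfolding eigenvalues_def by (intro CollectI exI[of _ v]) (auto simp: minus_equation_iff[of "K *v v"])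
    then show ?thesis using le by fastforce
  qed
  ultimately have "- l * (norm x)\<^sup>2 \<le> x \<bullet> ((- K) *v x)" by (rule eigenvalue_lower_bound)
  then show ?thesis by (simp add: neg)
qed

section \<open>Convex functions with Lipschitz gradient\<close>

lemma GDERIV_along_line:
  fixes G :: "'a::euclidean_space \<Rightarrow> real"
  assumes "\<And>x. GDERIV G x :> g x"
  shows "((\<lambda>s. G (x + s *\<^sub>R v)) has_real_derivative (v \<bullet> g (x + s *\<^sub>R v))) (at s)"
proof -
  have "((\<lambda>s. x + s *\<^sub>R v) has_derivative (\<lambda>h. h *\<^sub>R v)) (at s)"
    by (auto intro!: derivative_eq_intros)
  from has_derivative_compose[OF this assms[unfolded gderiv_def]]
  show ?thesis
    by (simp add: has_field_derivative_def mult.commute[of _ "v \<bullet> _"])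
qed

text \<open>Restriction to the line through \<open>x\<close> and \<open>y\<close> reduces this to
  the tangent inequality for a convex function of one real variable.\<close>

lemma convex_gradient_inequality:
  fixes G :: "'a::euclidean_space \<Rightarrow> real"
  assumes "convex_on UNIV G" and G: "\<And>x. GDERIV G x :> g x"
  shows "G y \<ge> G x + (y - x) \<bullet> g x"
proof -
  define \<phi> where "\<phi> s = G (x + s *\<^sub>R (y - x))" for s
  have "convex_on UNIV \<phi>"
  proof (rule convex_onI)
    fix t a b :: real assume t: "0 < t" "t < 1"
    have "\<phi> ((1 - t) *\<^sub>R a + t *\<^sub>R b) =
        G ((1 - t) *\<^sub>R (x + a *\<^sub>R (y - x)) + t *\<^sub>R (x + b *\<^sub>R (y - x)))"
      unfolding \<phi>_def by (rule arg_cong[of _ _ G]) (simp add: algebra_simps)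
    also have "\<dots> \<le> (1 - t) * \<phi> a + t * \<phi> b"
      unfolding \<phi>_def using t by (intro convex_onD[OF assms(1)]) auto
    finally show "\<phi> ((1 - t) *\<^sub>R a + t *\<^sub>R b) \<le> (1 - t) * \<phi> a + t * \<phi> b" .
  qed auto
  moreover have "(\<phi> has_real_derivative ((y - x) \<bullet> g x)) (at 0)"
    using GDERIV_along_line[OF G, of x "y - x" 0] by (simp add: \<phi>_def [abs_def])
  ultimately have "\<phi> 1 - \<phi> 0 \<ge> ((y - x) \<bullet> g x) * (1 - 0)"
    by (intro convex_on_imp_above_tangent[of UNIV]) auto
  then show ?thesis by (simp add: \<phi>_def)
qed

text \<open>Along the segment from \<open>x\<close> to \<open>x + v\<close>, the defect
  \<open>\<phi>\<close> has a nonpositive derivative by Cauchy-Schwarz and the Lipschitz bound, and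
  \<open>\<phi> 0 = G x\<close>.\<close>

lemma descent_inequality:
  fixes G :: "'a::euclidean_space \<Rightarrow> real"
  assumes lip: "L-lipschitz_on UNIV g" and G: "\<And>x. GDERIV G x :> g x"
  shows "G (x + v) \<le> G x + v \<bullet> g x + L / 2 * (norm v)\<^sup>2"
proof -
  define \<phi> where "\<phi> s = G (x + s *\<^sub>R v) - s * (v \<bullet> g x) - L / 2 * s\<^sup>2 * (norm v)\<^sup>2" for s
  have d: "(\<phi> has_real_derivative (v \<bullet> g (x + s *\<^sub>R v) - v \<bullet> g x - L * s * (norm v)\<^sup>2)) (at s)" for s
    unfolding \<phi>_def [abs_def]
    by (rule derivative_eq_intros GDERIV_along_line[OF G] refl | simp)+
  have "\<phi> 1 \<le> \<phi> 0"
  proof (rule DERIV_nonpos_imp_nonincreasing[of 0 1 \<phi>])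
    fix s :: real assume s: "0 \<le> s" "s \<le> 1"
    have "v \<bullet> g (x + s *\<^sub>R v) - v \<bullet> g x = v \<bullet> (g (x + s *\<^sub>R v) - g x)" by (simp add: inner_diff_right)
    also have "\<dots> \<le> norm v * norm (g (x + s *\<^sub>R v) - g x)" by (rule norm_cauchy_schwarz)
    also have "\<dots> \<le> norm v * (L * norm (x + s *\<^sub>R v - x))"
      using lipschitz_onD[OF lip, of "x + s *\<^sub>R v" x]
      by (intro mult_left_mono) (auto simp: dist_norm)
    also have "\<dots> = L * s * (norm v)\<^sup>2" using s by (simp add: power2_eq_square)
    finally show "\<exists>y. (\<phi> has_real_derivative y) (at s) \<and> y \<le> 0" using d[of s] by force
  qed simp
  then show ?thesis by (simp add: \<phi>_def)
qed

text \<open>The tilted function \<open>\<lambda>z. G z - z \<bullet> g x\<close> is convex with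
  minimum at \<open>x\<close> and has gradient \<open>g y - g x\<close> at \<open>y\<close>. The
  vector \<open>v\<close> is a gradient step of length \<open>1 / L\<close> from \<open>y\<close>;
  by descent it lowers the value by at least the quadratic term, and the result is still above the
  minimum.\<close>

lemma cocoercive_aux:
  fixes G :: "'a::euclidean_space \<Rightarrow> real"
  assumes convex: "convex_on UNIV G" and lip: "L-lipschitz_on UNIV g" and G: "\<And>x. GDERIV G x :> g x"
    and "L > 0"
  shows "G x + (y - x) \<bullet> g x + (norm (g y - g x))\<^sup>2 / (2 * L) \<le> G y"
proof -
  define v where "v = (- 1 / L) *\<^sub>R (g y - g x)"
  have "G x + (y + v - x) \<bullet> g x \<le> G (y + v)"
    by (rule convex_gradient_inequality[OF convex G])
  also have "\<dots> \<le> G y + v \<bullet> g y + L / 2 * (norm v)\<^sup>2" by (rule descent_inequality[OF lip G])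
  finally have "G x + (y - x) \<bullet> g x \<le> G y + v \<bullet> (g y - g x) + L / 2 * (norm v)\<^sup>2"
    by (simp add: inner_add_left inner_diff_left inner_diff_right)
  moreover have "v \<bullet> (g y - g x) = - (norm (g y - g x))\<^sup>2 / L"
    unfolding v_def by (simp add: power2_norm_eq_inner)
  moreover have "L / 2 * (norm v)\<^sup>2 = (norm (g y - g x))\<^sup>2 / (2 * L)"
    unfolding v_def norm_scaleR using \<open>L > 0\<close> by (simp add: power_mult_distrib power2_eq_square)
  ultimately show ?thesis by (simp add: field_simps)
qed

text \<open>Sum of the preceding inequality and the one with \<open>x\<close> and \<open>y\<close>
  exchanged. It is stronger than the Lipschitz bound in that it controls the gradient difference by
  \<open>(x - y) \<bullet> (g x - g y)\<close>, a quantity that the drift dissipates. The case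
  \<open>L = 0\<close> is separate because of the division by \<open>L\<close>.\<close>

lemma gradient_cocoercive:
  fixes G :: "'a::euclidean_space \<Rightarrow> real"
  assumes convex: "convex_on UNIV G" and lip: "L-lipschitz_on UNIV g" and G: "\<And>x. GDERIV G x :> g x"
  shows "(norm (g x - g y))\<^sup>2 \<le> L * ((x - y) \<bullet> (g x - g y))"
proof (cases "L = 0")
  case True
  then show ?thesis using lipschitz_onD[OF lip, of x y] by simp
next
  case False
  then have L: "L > 0" using lipschitz_on_nonneg[OF lip] by simp
  have "(norm (g x - g y))\<^sup>2 / (2 * L) + (norm (g x - g y))\<^sup>2 / (2 * L) \<le> (x - y) \<bullet> (g x - g y)"
    using cocoercive_aux[OF convex lip G L, of x y] cocoercive_aux[OF convex lip G L, of y x]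
    by (simp add: norm_minus_commute inner_diff_left inner_diff_right)
  then show ?thesis using L by (simp add: field_simps)
qed

section \<open>The Euler scheme for a continuous driving path\<close>

primrec euler :: "('a \<Rightarrow> 'a) \<Rightarrow> real \<Rightarrow> (real \<Rightarrow> 'a) \<Rightarrow> 'a \<Rightarrow> nat \<Rightarrow> 'a::real_normed_vector" where
  "euler b h s z 0 = z"
| "euler b h s z (Suc k) = euler b h s z k + h *\<^sub>R b (euler b h s z k) + (s (real (Suc k) * h) - s (real k * h))"

text \<open>Each inhomogeneity \<open>h * \<beta>\<close> is amplified by at most the full
  exponential. This yields \<open>real k * h * \<beta>\<close> in place of the sharper quotient by
  \<open>L\<close>, which would exclude \<open>L = 0\<close>.\<close>

lemma discrete_gronwall:
  fixes a :: "nat \<Rightarrow> real"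
  assumes "h \<ge> 0" "L \<ge> 0" "\<beta> \<ge> 0" "a 0 \<ge> 0"
    and step: "\<And>k. k < n \<Longrightarrow> a (Suc k) \<le> (1 + h * L) * a k + h * \<beta>"
    and "k \<le> n"
  shows "a k \<le> exp (L * (real k * h)) * (a 0 + real k * h * \<beta>)"
  using \<open>k \<le> n\<close>
proof (induction k)
  case (Suc k)
  have "a (Suc k) \<le> (1 + h * L) * a k + h * \<beta>" using Suc.prems by (intro step) simp
  also have "\<dots> \<le> (1 + h * L) * (exp (L * (real k * h)) * (a 0 + real k * h * \<beta>)) + h * \<beta>"
    using Suc assms by (intro add_right_mono mult_left_mono) auto
  also have "\<dots> \<le> exp (h * L) * (exp (L * (real k * h)) * (a 0 + real k * h * \<beta>))
      + exp (L * (real (Suc k) * h)) * (h * \<beta>)"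
    using assms mult_right_mono[of 1 "exp (L * (real (Suc k) * h))" "h * \<beta>"]
    by (intro add_mono mult_right_mono exp_ge_add_one_self) auto
  also have "\<dots> = exp (L * (real (Suc k) * h)) * (a 0 + real (Suc k) * h * \<beta>)"
    by (simp add: mult_exp_exp mult.assoc[symmetric]) (simp add: algebra_simps exp_add)
  finally show ?case .
qed simp

text \<open>\<open>W\<close> is any sequence that satisfies the recursion up to a defect
  \<open>h * \<eta>\<close> per step. It is used for a finer scheme observed on the coarse grid and
  for an exact solution sampled on the grid.\<close>

lemma euler_stability:
  fixes b :: "'a::real_normed_vector \<Rightarrow> 'a"
  assumes lip: "L-lipschitz_on UNIV b" and "h \<ge> 0" "\<eta> \<ge> 0"
    and "W 0 = z"
    and step: "\<And>k. k < n \<Longrightarrow>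
      norm (W (Suc k) - W k - h *\<^sub>R b (W k) - (s (real (Suc k) * h) - s (real k * h))) \<le> h * \<eta>"
  shows "norm (W n - euler b h s z n) \<le> exp (L * (real n * h)) * (real n * h * \<eta>)"
proof -
  define a where "a k = norm (W k - euler b h s z k)" for k
  have "a n \<le> exp (L * (real n * h)) * (a 0 + real n * h * \<eta>)"
  proof (rule discrete_gronwall[where n = n])
    fix k assume "k < n"
    let ?e = "euler b h s z k"
    have "W (Suc k) - euler b h s z (Suc k) =
        (W (Suc k) - W k - h *\<^sub>R b (W k) - (s (real (Suc k) * h) - s (real k * h)))
        + ((W k - ?e) + h *\<^sub>R (b (W k) - b ?e))"
      by (simp add: algebra_simps)
    then have "a (Suc k) \<le> h * \<eta> + norm ((W k - ?e) + h *\<^sub>R (b (W k) - b ?e))"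
      unfolding a_def by (simp only: norm_triangle_mono[OF step[OF \<open>k < n\<close>] order_refl])
    also have "norm ((W k - ?e) + h *\<^sub>R (b (W k) - b ?e)) \<le> a k + h * (L * a k)"
      unfolding a_def
    proof (rule norm_triangle_mono)
      show "norm (h *\<^sub>R (b (W k) - b ?e)) \<le> h * (L * norm (W k - ?e))"
        using lipschitz_onD[OF lip, of "W k" ?e] \<open>h \<ge> 0\<close> by (auto simp: dist_norm intro!: mult_left_mono)
    qed simp
    finally show "a (Suc k) \<le> (1 + h * L) * a k + h * \<eta>" by (simp add: algebra_simps)
  qed (use assms lipschitz_on_nonneg[OF lip] in \<open>auto simp: a_def\<close>)
  then show ?thesis using \<open>W 0 = z\<close> by (simp add: a_def)
qed

text \<open>The bound is uniform in the step size. The recursion is run for the scheme minus the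
  driving path: then only the size of \<open>s\<close> enters, through the drift. Summing the norms
  of the increments of \<open>s\<close> instead would produce its variation, which is infinite for
  Brownian paths.\<close>

lemma euler_bounded:
  fixes b :: "'a::real_normed_vector \<Rightarrow> 'a"
  assumes lip: "L-lipschitz_on UNIV b" and "t \<ge> 0" and S: "\<And>r. r \<in> {0..t} \<Longrightarrow> norm (s r) \<le> S"
  shows "\<exists>R. \<forall>h n k. h \<ge> 0 \<longrightarrow> real n * h = t \<longrightarrow> k \<le> n \<longrightarrow> norm (euler b h s z k) \<le> R"
proof (intro exI allI impI)
  fix h :: real and n k :: nat
  assume h: "h \<ge> 0" and nh: "real n * h = t" and "k \<le> n"
  have L: "L \<ge> 0" using lipschitz_on_nonneg[OF lip] .
  have S0: "S \<ge> 0" using order_trans[OF norm_ge_zero S[of 0]] \<open>t \<ge> 0\<close> by simp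
  have in_t: "real j * h \<in> {0..t}" if "j \<le> n" for j
    using that h nh mult_right_mono[of "real j" "real n" h] by auto
  define \<beta> where "\<beta> = norm (b 0) + L * S"
  define a where "a j = norm (euler b h s z j - s (real j * h))" for j
  have "\<beta> \<ge> 0" using L S0 by (simp add: \<beta>_def)
  have "a k \<le> exp (L * (real k * h)) * (a 0 + real k * h * \<beta>)"
  proof (rule discrete_gronwall[where n = n])
    fix j assume j: "j < n"
    let ?e = "euler b h s z j"
    have "norm (b ?e) \<le> norm (b 0) + L * norm ?e"
      using lipschitz_onD[OF lip, of ?e 0] norm_triangle_sub[of "b ?e" "b 0"] by (simp add: dist_norm)
    also have "L * norm ?e \<le> L * (a j + S)"
      using norm_triangle_sub[of ?e "s (real j * h)"] S[OF in_t[of j]] j L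
      by (intro mult_left_mono) (auto simp: a_def)
    finally have "norm (b ?e) \<le> \<beta> + L * a j" by (simp add: \<beta>_def algebra_simps)
    then have "h * norm (b ?e) \<le> h * (\<beta> + L * a j)" using h by (rule mult_left_mono)
    moreover have "a (Suc j) \<le> a j + h * norm (b ?e)"
      using norm_triangle_ineq[of "?e - s (real j * h)" "h *\<^sub>R b ?e"] h
      by (simp add: a_def algebra_simps)
    ultimately show "a (Suc j) \<le> (1 + h * L) * a j + h * \<beta>" by (simp add: algebra_simps)
  qed (use h L \<open>\<beta> \<ge> 0\<close> \<open>k \<le> n\<close> in \<open>auto simp: a_def\<close>)
  also have "\<dots> \<le> exp (L * t) * (a 0 + t * \<beta>)"
    using in_t[OF \<open>k \<le> n\<close>] L \<open>\<beta> \<ge> 0\<close> h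
    by (intro mult_mono add_mono mult_right_mono mult_left_mono iffD2[OF exp_le_cancel_iff])
      (auto simp: a_def)
  also have "a 0 = norm (z - s 0)" by (simp add: a_def)
  finally have "a k \<le> exp (L * t) * (norm (z - s 0) + t * \<beta>)" .
  then show "norm (euler b h s z k) \<le> exp (L * t) * (norm (z - s 0) + t * (norm (b 0) + L * S)) + S"
    using norm_triangle_sub[of "euler b h s z k" "s (real k * h)"] S[OF in_t[OF \<open>k \<le> n\<close>]]
    by (simp add: a_def \<beta>_def)
qed

lemma euler_increment:
  "euler b h s z (k + j) - euler b h s z k =
    h *\<^sub>R (\<Sum>i<j. b (euler b h s z (k + i))) + (s (real (k + j) * h) - s (real k * h))"
  by (induction j) (auto simp: algebra_simps)

text \<open>Observed every \<open>m\<close> steps, the fine scheme obeys the coarse recursion up to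
  the change of the drift inside a coarse cell. There it moves by at most the drift bound times
  \<open>h\<close> plus the oscillation of \<open>s\<close>, so the threshold \<open>N\<close> does
  not depend on \<open>m\<close>.\<close>

lemma euler_refine:
  fixes b :: "'a::real_normed_vector \<Rightarrow> 'a"
  assumes lip: "L-lipschitz_on UNIV b" and t: "t \<ge> 0" and cont: "continuous_on {0..t} s" and "\<epsilon> > 0"
  shows "\<exists>N>0. \<forall>n\<ge>N. \<forall>m>0.
    norm (euler b (t / real (n * m)) s z (n * m) - euler b (t / real n) s z n) < \<epsilon>"
proof -
  have L: "L \<ge> 0" using lipschitz_on_nonneg[OF lip] .
  have "bounded (s ` {0..t})" by (intro compact_imp_bounded compact_continuous_image cont) simp
  then obtain S where S: "\<And>r. r \<in> {0..t} \<Longrightarrow> norm (s r) \<le> S"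
    by (auto simp: bounded_iff simp del: atLeastAtMost_iff)
  obtain R where "\<forall>h n k. h \<ge> 0 \<longrightarrow> real n * h = t \<longrightarrow> k \<le> n \<longrightarrow> norm (euler b h s z k) \<le> R"
    using euler_bounded[OF lip t, of s S z] S by blast
  note R = this[rule_format]
  define \<beta> where "\<beta> = norm (b 0) + L * R"
  have "R \<ge> 0" using order_trans[OF norm_ge_zero R[of t 1 0]] t by simp
  then have \<beta>: "\<beta> \<ge> 0" using L by (simp add: \<beta>_def)
  \<comment> \<open>The factor from \<open>euler_stability\<close>, increased by 1 to be positive
    also for \<open>L = 0\<close> or \<open>t = 0\<close> and to make the final estimate
    strict.\<close>
  define C where "C = exp (L * t) * t * L + 1"
  have C: "C > 0" using L t by (auto simp: C_def intro!: add_nonneg_pos)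
  define \<delta> where "\<delta> = \<epsilon> / (2 * C)"
  have \<delta>: "\<delta> > 0" using \<open>\<epsilon> > 0\<close> C by (simp add: \<delta>_def)
  have "uniformly_continuous_on {0..t} s" by (intro compact_uniformly_continuous cont) simp
  then obtain d where d: "d > 0"
    and unif: "\<And>r r'. r \<in> {0..t} \<Longrightarrow> r' \<in> {0..t} \<Longrightarrow> dist r r' < d \<Longrightarrow> dist (s r) (s r') < \<delta>"
    using \<delta> unfolding uniformly_continuous_on_def by metis
  \<comment> \<open>For \<open>n \<ge> N\<close> the cell length \<open>h = t / n\<close> satisfies
    both \<open>h < d\<close> (oscillation of the path) and \<open>h * \<beta> < \<delta>\<close>
    (displacement by the drift); the two contributions give the \<open>2 * \<delta>\<close>
    below.\<close>
  obtain N :: nat where N: "real N > t / d + t * \<beta> / \<delta>" using reals_Archimedean2 by blast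
  have "0 \<le> t / d + t * \<beta> / \<delta>" using d \<delta> \<beta> t by (intro add_nonneg_nonneg) auto
  then have "N > 0" using N by (intro gr0I) auto
  moreover have "norm (euler b (t / real (n * m)) s z (n * m) - euler b (t / real n) s z n) < \<epsilon>"
    if n: "n \<ge> N" and m: "m > 0" for n m
  proof -
    have n0: "n > 0" using n \<open>N > 0\<close> by simp
    define h where "h = t / real n"
    define h' where "h' = t / real (n * m)"
    have hh: "h = real m * h'" and h: "h \<ge> 0" and h': "h' \<ge> 0" and nh: "real n * h = t"
      and nmh': "real (n * m) * h' = t"
      using n0 m t by (auto simp: h_def h'_def)
    have "t / d < real n" "t * \<beta> / \<delta> < real n"
      using N n t d \<delta> \<beta> by (smt (verit) divide_nonneg_pos mult_nonneg_nonneg of_nat_mono)+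
    then have hd: "h < d" and h\<beta>: "h * \<beta> < \<delta>"
      using d \<delta> n0 by (auto simp: h_def field_simps)
    let ?e = "euler b h' s z"
    have be: "norm (b (?e j)) \<le> \<beta>" if "j \<le> n * m" for j
    proof -
      have "norm (b (?e j)) \<le> norm (b 0) + L * norm (?e j)"
        using lipschitz_onD[OF lip, of "?e j" 0] norm_triangle_sub[of "b (?e j)" "b 0"] by (simp add: dist_norm)
      also have "L * norm (?e j) \<le> L * R" using R[OF h' nmh' that] L by (rule mult_left_mono)
      finally show ?thesis by (simp add: \<beta>_def)
    qed
    have osc: "norm (?e (k * m + i) - ?e (k * m)) \<le> 2 * \<delta>" if k: "k < n" and i: "i < m" for k i
    proof -
      have "(k + 1) * m \<le> n * m" using k by (intro mult_right_mono) auto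
      then have km: "k * m + m \<le> n * m" by simp
      have "norm (h' *\<^sub>R (\<Sum>j<i. b (?e (k * m + j)))) \<le> h' * (real i * \<beta>)"
        using h' be km i sum_norm_bound[of "{..<i}" "\<lambda>j. b (?e (k * m + j))" \<beta>]
        by (auto intro!: mult_left_mono)
      also have "\<dots> \<le> h' * (real m * \<beta>)" using i h' \<beta> by (intro mult_left_mono mult_right_mono) auto
      also have "\<dots> < \<delta>" using h\<beta> by (simp add: hh mult_ac)
      finally have 1: "norm (h' *\<^sub>R (\<Sum>j<i. b (?e (k * m + j)))) \<le> \<delta>" by simp
      have le: "real j * h' \<le> t" if "j \<le> n * m" for j
        using mult_right_mono[of "real j" "real (n * m)" h'] h' that nmh' by (simp del: of_nat_mult)
      have "dist (real (k * m + i) * h') (real (k * m) * h') = real i * h'"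
        using h' by (simp add: dist_real_def algebra_simps)
      also have "\<dots> \<le> real m * h'" using i h' by (intro mult_right_mono) auto
      also have "\<dots> < d" using hd hh by simp
      finally have "dist (s (real (k * m + i) * h')) (s (real (k * m) * h')) < \<delta>"
        using le[of "k * m + i"] le[of "k * m"] km i h' add_leD1[OF km] by (intro unif) auto
      then have 2: "norm (s (real (k * m + i) * h') - s (real (k * m) * h')) \<le> \<delta>"
        by (simp add: dist_norm)
      show ?thesis unfolding euler_increment using norm_triangle_mono[OF 1 2] by simp
    qed
    have "norm (?e (n * m) - euler b h s z n) \<le> exp (L * (real n * h)) * (real n * h * (L * (2 * \<delta>)))"
    proof (rule euler_stability[OF lip h, where W = "\<lambda>k. ?e (k * m)"])
      fix k assume k: "k < n"
      have "?e (Suc k * m) - ?e (k * m) - h *\<^sub>R b (?e (k * m)) - (s (real (Suc k) * h) - s (real k * h))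
          = h' *\<^sub>R (\<Sum>i<m. b (?e (k * m + i)) - b (?e (k * m)))"
        using euler_increment[of b h' s z "k * m" m]
        by (simp add: hh sum_subtractf sum_constant_scaleR algebra_simps del: sum_constant)
      also have "norm \<dots> \<le> h' * (real m * (L * (2 * \<delta>)))"
      proof -
        have "norm (b (?e (k * m + i)) - b (?e (k * m))) \<le> L * (2 * \<delta>)" if "i < m" for i
        proof -
          have "norm (b (?e (k * m + i)) - b (?e (k * m))) \<le> L * norm (?e (k * m + i) - ?e (k * m))"
            using lipschitz_onD[OF lip] by (simp add: dist_norm)
          also have "\<dots> \<le> L * (2 * \<delta>)" using L by (intro mult_left_mono osc k that)
          finally show ?thesis .
        qed
        then have "norm (\<Sum>i<m. b (?e (k * m + i)) - b (?e (k * m))) \<le> real m * (L * (2 * \<delta>))"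
          using sum_norm_bound[of "{..<m}" "\<lambda>i. b (?e (k * m + i)) - b (?e (k * m))" "L * (2 * \<delta>)"] by simp
        then show ?thesis using h' by (auto intro: mult_left_mono)
      qed
      also have "\<dots> = h * (L * (2 * \<delta>))" by (simp add: hh)
      finally show "norm (?e (Suc k * m) - ?e (k * m) - h *\<^sub>R b (?e (k * m))
        - (s (real (Suc k) * h) - s (real k * h))) \<le> h * (L * (2 * \<delta>))" .
    qed (use L \<delta> in auto)
    also have "\<dots> = (exp (L * t) * t * L) * (2 * \<delta>)" by (simp add: nh)
    also have "\<dots> < C * (2 * \<delta>)" using \<delta> by (intro mult_strict_right_mono) (auto simp: C_def)
    also have "\<dots> = \<epsilon>" using C by (simp add: \<delta>_def)
    finally show ?thesis by (simp add: h_def h'_def)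
  qed
  ultimately show ?thesis by blast
qed

text \<open>The schemes with \<open>n\<close> and \<open>m\<close> steps are both compared with the one with
  \<open>n * m\<close> steps.\<close>

lemma euler_convergent:
  fixes b :: "'a::banach \<Rightarrow> 'a"
  assumes lip: "L-lipschitz_on UNIV b" and t: "t \<ge> 0" and cont: "continuous_on {0..t} s"
  shows "convergent (\<lambda>n. euler b (t / real n) s z n)"
proof (rule Cauchy_convergent, rule CauchyI)
  fix e :: real assume "e > 0"
  then obtain N where N: "N > 0" "\<And>n m. n \<ge> N \<Longrightarrow> m > 0 \<Longrightarrow>
    norm (euler b (t / real (n * m)) s z (n * m) - euler b (t / real n) s z n) < e / 2"
    using euler_refine[OF lip t cont, of "e / 2"] by (metis half_gt_zero)
  have "norm (euler b (t / real m) s z m - euler b (t / real n) s z n) < e" if "m \<ge> N" "n \<ge> N" for m n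
    using N(2)[of n m] N(2)[of m n] that \<open>N > 0\<close>
      dist_triangle_half_l[of "euler b (t / real m) s z m" "euler b (t / real (n * m)) s z (n * m)" e
        "euler b (t / real n) s z n"]
    by (simp add: dist_norm norm_minus_commute mult.commute)
  then show "\<exists>M. \<forall>m\<ge>M. \<forall>n\<ge>M. norm (euler b (t / real m) s z m - euler b (t / real n) s z n) < e"
    by blast
qed

text \<open>On a cell, the solution misses the Euler step by the integral of
  \<open>b (Z r) - b (Z p)\<close>, which is small by uniform continuity of \<open>Z\<close>. The
  constant \<open>\<zeta>\<close> cancels in increments. Together with uniqueness of limits this
  also shows that the path and the initial value determine the solution.\<close>

lemma euler_tendsto_solution:
  fixes b :: "'a::euclidean_space \<Rightarrow> 'a"
  assumes lip: "L-lipschitz_on UNIV b" and t: "t \<ge> 0" and cont: "continuous_on {0..t} Z"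
    and sol: "\<And>r. r \<in> {0..t} \<Longrightarrow> Z r = \<zeta> + integral {0..r} (\<lambda>r. b (Z r)) + s r"
  shows "(\<lambda>n. euler b (t / real n) s (Z 0) n) \<longlonglongrightarrow> Z t"
proof (rule LIMSEQ_I)
  fix e :: real assume "e > 0"
  have L: "L \<ge> 0" using lipschitz_on_nonneg[OF lip] .
  define C where "C = exp (L * t) * t * L + 1"
  have C: "C > 0" using L t by (auto simp: C_def intro!: add_nonneg_pos)
  define \<delta> where "\<delta> = e / C"
  have \<delta>: "\<delta> > 0" using \<open>e > 0\<close> C by (simp add: \<delta>_def)
  have contb: "continuous_on {0..t} (\<lambda>r. b (Z r))"
    using continuous_on_compose2[OF lipschitz_on_continuous_on[OF lip] cont] by auto
  have "uniformly_continuous_on {0..t} Z" by (intro compact_uniformly_continuous cont) simp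
  then obtain d where d: "d > 0"
    and unif: "\<And>r r'. r \<in> {0..t} \<Longrightarrow> r' \<in> {0..t} \<Longrightarrow> dist r r' < d \<Longrightarrow> dist (Z r) (Z r') < \<delta>"
    using \<delta> unfolding uniformly_continuous_on_def by metis
  obtain N :: nat where N: "real N > t / d" using reals_Archimedean2 by blast
  have "norm (euler b (t / real n) s (Z 0) n - Z t) < e" if n: "n \<ge> N" for n
  proof -
    have "real n > t / d" using N n by linarith
    then have n0: "n > 0" using t d by (intro gr0I) (auto simp: not_less divide_less_0_iff)
    define h where "h = t / real n"
    have h: "h \<ge> 0" and nh: "real n * h = t" using n0 t by (auto simp: h_def)
    have hd: "h < d" using \<open>real n > t / d\<close> d n0 by (simp add: h_def field_simps)
    have "norm (Z (real n * h) - euler b h s (Z 0) n) \<le> exp (L * (real n * h)) * (real n * h * (L * \<delta>))"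
    proof (rule euler_stability[OF lip h, where W = "\<lambda>k. Z (real k * h)"])
      fix k assume k: "k < n"
      define p q where "p = real k * h" and "q = real (Suc k) * h"
      have pq: "0 \<le> p" "p \<le> q" "q \<le> t" "q - p = h"
        using h k by (auto simp: p_def q_def algebra_simps simp flip: nh intro!: mult_right_mono)
          (metis Suc_leI distrib_right mult.commute mult_left_mono mult_1 of_nat_Suc of_nat_mono)
      have int: "(\<lambda>r. b (Z r)) integrable_on {x..y}" if "0 \<le> x" "y \<le> t" for x y
        using that by (intro integrable_continuous_real continuous_on_subset[OF contb]) auto
      have "integral {0..q} (\<lambda>r. b (Z r)) = integral {0..p} (\<lambda>r. b (Z r)) + integral {p..q} (\<lambda>r. b (Z r))"
        using pq by (intro Henstock_Kurzweil_Integration.integral_combine[symmetric] int) auto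
      then have "Z q - Z p - h *\<^sub>R b (Z p) - (s q - s p) = integral {p..q} (\<lambda>r. b (Z r)) - h *\<^sub>R b (Z p)"
        using sol[of p] sol[of q] pq by simp
      also have "\<dots> = integral {p..q} (\<lambda>r. b (Z r) - b (Z p))"
        using pq int by (subst integral_diff) auto
      also have "norm \<dots> \<le> (L * \<delta>) * (q - p)"
      proof (rule integral_bound)
        show "continuous_on {p..q} (\<lambda>r. b (Z r) - b (Z p))"
          using pq by (intro continuous_intros continuous_on_subset[OF contb]) auto
        fix r assume r: "r \<in> {p..q}"
        have "norm (b (Z r) - b (Z p)) \<le> L * dist (Z r) (Z p)"
          using lipschitz_onD[OF lip] by (simp add: dist_norm)
        also have "\<dots> \<le> L * \<delta>"
          using L r pq hd less_imp_le[OF unif[of r p]] by (intro mult_left_mono) (auto simp: dist_real_def)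
        finally show "norm (b (Z r) - b (Z p)) \<le> L * \<delta>" .
      qed (use pq in auto)
      finally show "norm (Z (real (Suc k) * h) - Z (real k * h) - h *\<^sub>R b (Z (real k * h))
          - (s (real (Suc k) * h) - s (real k * h))) \<le> h * (L * \<delta>)"
        using pq by (simp add: p_def q_def mult.commute)
    qed (use L \<delta> in auto)
    also have "\<dots> = (exp (L * t) * t * L) * \<delta>" by (simp add: nh)
    also have "\<dots> < C * \<delta>" using \<delta> by (intro mult_strict_right_mono) (auto simp: C_def)
    also have "\<dots> = e" using C by (simp add: \<delta>_def)
    finally show ?thesis by (simp add: nh norm_minus_commute) (simp add: h_def)
  qed
  then show "\<exists>N. \<forall>n\<ge>N. norm (euler b (t / real n) s (Z 0) n - Z t) < e" by blast
qed

section \<open>Contraction of the Euler scheme\<close>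

definition langevin_drift :: "real \<Rightarrow> real \<Rightarrow> (real ^ 'n \<Rightarrow> real) \<Rightarrow> (real ^ 'n) \<times> (real ^ 'n) \<Rightarrow> (real ^ 'n) \<times> (real ^ 'n)" where
  "langevin_drift u \<gamma> V z = (snd z, - \<gamma> *\<^sub>R snd z - u *\<^sub>R grad V (fst z))"

text \<open>The polarised form of the squared distance: the diagonal is the square of
  \<open>langevin_dist\<close>, and \<open>langevin_form u \<gamma> l K D E\<close> is half the
  derivative of the diagonal when \<open>D\<close> moves with velocity \<open>E\<close>, for
  symmetric \<open>K\<close>.\<close>

definition langevin_form :: "real \<Rightarrow> real \<Rightarrow> real \<Rightarrow> real ^ 'n ^ 'n \<Rightarrow>
    (real ^ 'n) \<times> (real ^ 'n) \<Rightarrow> (real ^ 'n) \<times> (real ^ 'n) \<Rightarrow> real" where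
  "langevin_form u \<gamma> l K D E =
    u / \<gamma>\<^sup>2 * (fst D \<bullet> (K *v fst E))
    + 1 / 2 * (((1 - 2 * l) *\<^sub>R fst D + (1 / \<gamma>) *\<^sub>R snd D) \<bullet> ((1 - 2 * l) *\<^sub>R fst E + (1 / \<gamma>) *\<^sub>R snd E))
    + 1 / 2 * (1 / \<gamma>\<^sup>2) * (snd D \<bullet> snd E)"

lemma langevin_dist_eq:
  "langevin_dist u \<gamma> \<kappa> K z z' = sqrt (langevin_form u \<gamma> (langevin_lambda u \<gamma> \<kappa>) K (z - z') (z - z'))"
  by (simp add: langevin_dist_def langevin_form_def Let_def power2_norm_eq_inner)

lemma langevin_form_add_scaleR:
  fixes K :: "real ^ 'n ^ 'n"
  assumes "transpose K = K"
  shows "langevin_form u \<gamma> l K (D + h *\<^sub>R E) (D + h *\<^sub>R E) =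
    langevin_form u \<gamma> l K D D + 2 * h * langevin_form u \<gamma> l K D E + h\<^sup>2 * langevin_form u \<gamma> l K E E"
proof -
  have sc: "(1 - 2 * l) *\<^sub>R fst (D + h *\<^sub>R E) + (1 / \<gamma>) *\<^sub>R snd (D + h *\<^sub>R E) =
     ((1 - 2 * l) *\<^sub>R fst D + (1 / \<gamma>) *\<^sub>R snd D) + h *\<^sub>R ((1 - 2 * l) *\<^sub>R fst E + (1 / \<gamma>) *\<^sub>R snd E)"
    by (simp add: algebra_simps)
  have ip: "(x + h *\<^sub>R y) \<bullet> (x + h *\<^sub>R y) = x \<bullet> x + 2 * h * (x \<bullet> y) + h\<^sup>2 * (y \<bullet> y)" for x y :: "real ^ 'n"
    by (simp add: inner_add_left inner_add_right inner_commute power2_eq_square algebra_simps)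
  have K: "(x + h *\<^sub>R y) \<bullet> (K *v (x + h *\<^sub>R y)) = x \<bullet> (K *v x) + 2 * h * (x \<bullet> (K *v y)) + h\<^sup>2 * (y \<bullet> (K *v y))" for x y
    using quadratic_form_add_scaleR[OF assms, of x h y] inner_matrix_commute[OF assms, of x y] by simp
  have gen: "\<alpha> * (p + 2 * h * q + h\<^sup>2 * r) + 1 / 2 * (p' + 2 * h * q' + h\<^sup>2 * r')
      + 1 / 2 * \<beta> * (p'' + 2 * h * q'' + h\<^sup>2 * r'')
    = \<alpha> * p + 1 / 2 * p' + 1 / 2 * \<beta> * p'' + 2 * h * (\<alpha> * q + 1 / 2 * q' + 1 / 2 * \<beta> * q'')
      + h\<^sup>2 * (\<alpha> * r + 1 / 2 * r' + 1 / 2 * \<beta> * r'')" for \<alpha> \<beta> p q r p' q' r' p'' q'' r'' :: real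
    by (simp add: field_simps)
  show ?thesis
    unfolding langevin_form_def sc unfolding fst_add snd_add fst_scaleR snd_scaleR ip K
    by (rule gen)
qed

text \<open>Only deterministic data are collected here: the contraction results inside hold for
  every driving path.\<close>

locale langevin_potential =
  fixes u \<gamma> \<kappa> L_K L_G :: real and K :: "real ^ 'n ^ 'n" and V G :: "real ^ 'n \<Rightarrow> real"
  assumes u: "u > 0" and \<gamma>: "\<gamma> > 0" and V: "C2 V" and V_eq: "\<And>x. V x = 1 / 2 * (x \<bullet> (K *v x)) + G x"
    and pd: "positive_definite K" and \<kappa>_le: "\<And>a. a \<in> eigenvalues K \<Longrightarrow> \<kappa> \<le> a" and \<kappa>: "\<kappa> > 0"
    and le_L_K: "\<And>a. a \<in> eigenvalues K \<Longrightarrow> a \<le> L_K"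
    and convex: "convex_on UNIV G" and lip: "L_G-lipschitz_on UNIV (grad G)"
    and L_G: "L_G * u / \<gamma>\<^sup>2 \<le> 3 / 4"
begin

abbreviation "b \<equiv> langevin_drift u \<gamma> V"
abbreviation "lam \<equiv> langevin_lambda u \<gamma> \<kappa>"
abbreviation "Q \<equiv> langevin_form u \<gamma> lam K"

lemma K_sym: "transpose K = K" using pd by (simp add: positive_definite_def)

lemma lam_bounds: "0 < lam" "lam \<le> 1 / 8" "2 * lam \<le> u / \<gamma>\<^sup>2 * \<kappa>"
proof -
  show "0 < lam" using u \<gamma> \<kappa> by (simp add: langevin_lambda_def)
  show "lam \<le> 1 / 8" by (simp add: langevin_lambda_def)
  have "lam \<le> (u / \<gamma>\<^sup>2 * \<kappa>) / 2"
    unfolding langevin_lambda_def by (rule min.coboundedI2) (simp add: mult.commute)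
  moreover have "x \<le> y / 2 \<Longrightarrow> 2 * x \<le> y" for x y :: real by simp
  ultimately show "2 * lam \<le> u / \<gamma>\<^sup>2 * \<kappa>" by blast
qed

text \<open>\<open>grad\<close> is a definite description, so \<open>grad G\<close> carries
  information only once \<open>G\<close> is known to be differentiable. This follows from
  \<open>G\<close> being \<open>V\<close> minus a quadratic form.\<close>

lemma G_gradient: "GDERIV G x :> grad V x - K *v x"
proof -
  have "((\<lambda>x. x \<bullet> (K *v x)) has_derivative (\<lambda>h. x \<bullet> (K *v h) + h \<bullet> (K *v x))) (at x)"
    by (intro has_derivative_inner has_derivative_ident
        bounded_linear.has_derivative[OF matrix_vector_mul_bounded_linear])
  then have "((\<lambda>x. 1 / 2 * (x \<bullet> (K *v x))) has_derivative
      (\<lambda>h. 1 / 2 * (x \<bullet> (K *v h) + h \<bullet> (K *v x)))) (at x)"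
    by (rule has_derivative_mult_right)
  moreover have "(\<lambda>h. 1 / 2 * (x \<bullet> (K *v h) + h \<bullet> (K *v x))) = (\<lambda>h. h \<bullet> (K *v x))"
    by (simp add: inner_matrix_commute[OF K_sym, of x])
  ultimately have "((\<lambda>x. 1 / 2 * (x \<bullet> (K *v x))) has_derivative (\<lambda>h. h \<bullet> (K *v x))) (at x)"
    by simp
  then have "((\<lambda>x. V x - 1 / 2 * (x \<bullet> (K *v x))) has_derivative (\<lambda>h. h \<bullet> grad V x - h \<bullet> (K *v x))) (at x)"
    using C2_grad[OF V, of x] unfolding gderiv_def by (intro has_derivative_diff)
  moreover have "(\<lambda>x. V x - 1 / 2 * (x \<bullet> (K *v x))) = G" using V_eq by auto
  ultimately show ?thesis by (simp add: gderiv_def inner_diff_right)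
qed

lemma grad_V: "grad V x = K *v x + grad G x"
  using grad_eq[OF G_gradient[of x]] by simp

lemma GDERIV_G: "GDERIV G x :> grad G x"
  using G_gradient[of x] by (simp add: grad_V)

lemma grad_G_monotone: "0 \<le> (x - y) \<bullet> (grad G x - grad G y)"
  using convex_gradient_inequality[OF convex GDERIV_G, of x y]
    convex_gradient_inequality[OF convex GDERIV_G, of y x]
  by (simp add: inner_diff_left inner_diff_right)

text \<open>Any constant will do: it serves for the convergence of the schemes and for the term of
  order \<open>h\<^sup>2\<close>, and neither affects the rate.\<close>

lemma drift_lipschitz: "\<exists>L. L-lipschitz_on UNIV b"
proof -
  obtain B where B: "B-lipschitz_on UNIV ((*v) K)"
    using bounded_linear.lipschitz_boundE[OF matrix_vector_mul_bounded_linear[of K]] by metis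
  obtain P where P: "P-lipschitz_on UNIV (fst :: (real ^ 'n) \<times> (real ^ 'n) \<Rightarrow> _)"
    using bounded_linear.lipschitz_boundE[OF bounded_linear_fst] by metis
  obtain R where R: "R-lipschitz_on UNIV (snd :: (real ^ 'n) \<times> (real ^ 'n) \<Rightarrow> _)"
    using bounded_linear.lipschitz_boundE[OF bounded_linear_snd] by metis
  have "(B + L_G)-lipschitz_on UNIV (grad V)"
    unfolding grad_V[abs_def] by (intro lipschitz_intros B lip)
  then have "((B + L_G) * P)-lipschitz_on UNIV (\<lambda>z :: (real ^ 'n) \<times> (real ^ 'n). grad V (fst z))"
    by (intro lipschitz_on_compose2[OF P]) (auto intro: lipschitz_on_subset)
  then have "\<exists>C. C-lipschitz_on UNIV (\<lambda>z. (snd z, (- \<gamma>) *\<^sub>R snd z - u *\<^sub>R grad V (fst z)))"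
    by (intro exI) (rule lipschitz_on_Pair lipschitz_on_diff lipschitz_on_cmult R | assumption)+
  then show ?thesis by (simp add: langevin_drift_def[abs_def])
qed

text \<open>The infinitesimal contraction, in the scaled velocity \<open>w\<close> and with
  \<open>a = u / \<gamma>\<^sup>2\<close>. After the cancellations, two groups of terms remain:
  those in \<open>g\<close> and \<open>w\<close>, nonpositive by cocoercivity and a completed
  square, and those in \<open>x\<close> alone, nonpositive by the spectral bound and the choice of
  \<lambda>.\<close>

lemma form_contraction: "Q (z - z') (b z - b z') \<le> - \<gamma> * lam * Q (z - z') (z - z')"
proof -
  define l q a where "l = lam" and "q = 1 - 2 * l" and "a = u / \<gamma>\<^sup>2"
  define x w g where "x = fst z - fst z'" and "w = (1 / \<gamma>) *\<^sub>R (snd z - snd z')"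
    and "g = grad G (fst z) - grad G (fst z')"
  note l = lam_bounds[folded l_def a_def]
  have a: "a > 0" and ua: "u = a * \<gamma>\<^sup>2" using u \<gamma> by (auto simp: a_def)
  have D: "z - z' = (x, \<gamma> *\<^sub>R w)" using \<gamma> by (simp add: x_def w_def prod_eq_iff)
  have E: "b z - b z' = (\<gamma> *\<^sub>R w, - (\<gamma>\<^sup>2 *\<^sub>R (w + a *\<^sub>R (K *v x + g))))"
    using \<gamma> by (simp add: langevin_drift_def grad_V x_def w_def g_def ua prod_eq_iff
        power2_eq_square algebra_simps matrix_vector_mult_diff_distrib)
  have Kwx: "x \<bullet> (K *v w) = w \<bullet> (K *v x)" by (rule inner_matrix_commute[OF K_sym])
  \<comment> \<open>The weights in the distance are chosen such that the terms in \<open>w \<bullet> (K *v x)\<close> and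
    \<open>x \<bullet> w\<close> cancel.\<close>
  have "Q (z - z') (b z - b z') + \<gamma> * l * Q (z - z') (z - z') =
    \<gamma> * (- (q / 2 - l) * a * (x \<bullet> (K *v x)) + l * q\<^sup>2 / 2 * (x \<bullet> x)
      - q * a / 2 * (x \<bullet> g) - a * (w \<bullet> g) - 1 / 2 * (w \<bullet> w))"
    unfolding D E langevin_form_def l_def[symmetric] q_def[symmetric] a_def[symmetric] using \<gamma>
    by (simp add: matrix_vector_mult_scaleR inner_add_left inner_add_right Kwx inner_commute[of w x]
        power2_eq_square field_simps) (simp add: q_def algebra_simps)
  also have "\<dots> \<le> 0"
  proof (rule mult_nonneg_nonpos)
    \<comment> \<open>Since \<open>l \<le> 1 / 8\<close>, the weight \<open>q\<close> is at least
      3/4.\<close>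
    have LGq: "L_G * u / \<gamma>\<^sup>2 \<le> q" using L_G l unfolding q_def by linarith
    have "(norm g)\<^sup>2 \<le> L_G * (x \<bullet> g)"
      unfolding x_def g_def by (rule gradient_cocoercive[OF convex lip GDERIV_G])
    then have "a * (g \<bullet> g) \<le> a * (L_G * (x \<bullet> g))"
      using a by (intro mult_left_mono) (auto simp: power2_norm_eq_inner)
    also have "\<dots> = (L_G * u / \<gamma>\<^sup>2) * (x \<bullet> g)" by (simp add: a_def)
    also have "L_G * u / \<gamma>\<^sup>2 * (x \<bullet> g) \<le> q * (x \<bullet> g)"
      using grad_G_monotone[of "fst z" "fst z'"] LGq unfolding x_def g_def by (intro mult_right_mono)
    finally have "a * (a * (g \<bullet> g)) \<le> a * (q * (x \<bullet> g))" using a by (intro mult_left_mono) auto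
    \<comment> \<open>The cross term \<open>- a * (w \<bullet> g)\<close> has no sign. The square
      splits it between \<open>w \<bullet> w\<close> and \<open>a * (a * (g \<bullet> g))\<close>,
      and the latter has just been bounded by the dissipated \<open>x \<bullet> g\<close>.\<close>
    moreover have "0 \<le> (w + a *\<^sub>R g) \<bullet> (w + a *\<^sub>R g)" by (rule inner_ge_zero)
    then have "0 \<le> w \<bullet> w + 2 * (a * (w \<bullet> g)) + a * (a * (g \<bullet> g))"
      by (simp add: inner_add_left inner_add_right inner_commute algebra_simps)
    ultimately have 1: "- (q * a / 2 * (x \<bullet> g)) - a * (w \<bullet> g) - 1 / 2 * (w \<bullet> w) \<le> 0"
      by (simp add: algebra_simps)
    \<comment> \<open>With \<open>q = 1 - 2 * l\<close> this amounts to
      \<open>4 * l + 4 * l\<^sup>2 \<le> 1\<close>. The factor \<open>2 * l\<close> is then replaced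
      by \<open>a * \<kappa>\<close>, the second bound in the definition of \<lambda>.\<close>
    have "l * q\<^sup>2 / 2 \<le> (q / 2 - l) * (2 * l)"
    proof -
      have "4 * l + 4 * l\<^sup>2 \<le> 1"
        using l mult_mono[of l "1 / 8" l "1 / 8"] by (simp add: power2_eq_square)
      then have "l * (4 * l + 4 * l\<^sup>2) \<le> l * 1" using l by (intro mult_left_mono) auto
      then show ?thesis by (simp add: q_def power2_eq_square field_simps)
    qed
    also have "\<dots> \<le> (q / 2 - l) * (a * \<kappa>)" using l by (intro mult_left_mono) (auto simp: q_def)
    finally have "l * q\<^sup>2 / 2 * (x \<bullet> x) \<le> (q / 2 - l) * (a * \<kappa>) * (x \<bullet> x)"
      by (rule mult_right_mono) simp
    also have "\<dots> = (q / 2 - l) * a * (\<kappa> * (norm x)\<^sup>2)" by (simp add: power2_norm_eq_inner)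
    also have "\<dots> \<le> (q / 2 - l) * a * (x \<bullet> (K *v x))"
      using l a by (intro mult_left_mono eigenvalue_lower_bound[OF K_sym \<kappa>_le]) (auto simp: q_def)
    finally show "- (q / 2 - l) * a * (x \<bullet> (K *v x)) + l * q\<^sup>2 / 2 * (x \<bullet> x)
      - q * a / 2 * (x \<bullet> g) - a * (w \<bullet> g) - 1 / 2 * (w \<bullet> w) \<le> 0"
      using 1 by (simp add: algebra_simps)
  qed (use \<gamma> in simp)
  finally show ?thesis by (simp add: l_def)
qed

text \<open>The cross term of the twisted square is split evenly: it adds 1/2 to the coefficient 1
  of the velocity and raises the coefficient of the position to at most
  \<open>\<gamma>\<^sup>2\<close>, as \<open>q \<le> 1\<close>.\<close>

lemma form_upper: "\<gamma>\<^sup>2 * Q z z \<le> max (u * L_K + \<gamma>\<^sup>2) (3 / 2) * (norm z)\<^sup>2"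
proof -
  define x y q where "x = fst z" and "y = snd z" and "q = 1 - 2 * lam"
  have q: "0 \<le> q" "q \<le> 1" using lam_bounds by (auto simp: q_def)
  have "0 \<le> (q *\<^sub>R \<gamma> *\<^sub>R x - y) \<bullet> (q *\<^sub>R \<gamma> *\<^sub>R x - y)" by (rule inner_ge_zero)
  then have yg: "2 * (q * \<gamma> * (x \<bullet> y)) \<le> q\<^sup>2 * \<gamma>\<^sup>2 * (x \<bullet> x) + y \<bullet> y"
    by (simp add: inner_diff_left inner_diff_right inner_commute power2_eq_square algebra_simps)
  have "\<gamma>\<^sup>2 * Q z z = u * (x \<bullet> (K *v x)) + q\<^sup>2 * \<gamma>\<^sup>2 * (x \<bullet> x) / 2 + q * \<gamma> * (x \<bullet> y) + y \<bullet> y"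
    unfolding langevin_form_def x_def[symmetric] y_def[symmetric] q_def[symmetric] using \<gamma>
    by (simp add: inner_add_left inner_add_right inner_commute power2_eq_square field_simps)
  also have "\<dots> \<le> u * (x \<bullet> (K *v x)) + q\<^sup>2 * \<gamma>\<^sup>2 * (x \<bullet> x) + 3 / 2 * (y \<bullet> y)"
    using yg by linarith
  also have "\<dots> \<le> u * (L_K * (norm x)\<^sup>2) + 1 * \<gamma>\<^sup>2 * (x \<bullet> x) + 3 / 2 * (y \<bullet> y)"
    using u q eigenvalue_upper_bound[OF K_sym le_L_K, of x]
    by (intro add_mono mult_left_mono mult_right_mono) (auto simp: power_le_one)
  also have "\<dots> = (u * L_K + \<gamma>\<^sup>2) * (norm x)\<^sup>2 + 3 / 2 * (norm y)\<^sup>2"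
    by (simp add: power2_norm_eq_inner algebra_simps)
  also have "\<dots> \<le> max (u * L_K + \<gamma>\<^sup>2) (3 / 2) * (norm x)\<^sup>2 + max (u * L_K + \<gamma>\<^sup>2) (3 / 2) * (norm y)\<^sup>2"
    by (intro add_mono mult_right_mono) auto
  also have "\<dots> = max (u * L_K + \<gamma>\<^sup>2) (3 / 2) * (norm z)\<^sup>2"
    by (simp add: x_def y_def norm_prod_def algebra_simps)
  finally show ?thesis .
qed

text \<open>The twisted square is dropped; the two remaining terms of
  \<open>\<gamma>\<^sup>2 * Q z z\<close> dominate \<open>u * \<kappa>\<close> times the squared
  position and half the squared velocity.\<close>

lemma form_lower: "(norm z)\<^sup>2 \<le> max (1 / (u * \<kappa>)) 2 * (\<gamma>\<^sup>2 * Q z z)"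
proof -
  define x y q m where "x = fst z" and "y = snd z" and "q = 1 - 2 * lam" and "m = max (1 / (u * \<kappa>)) 2"
  have m: "1 / (u * \<kappa>) \<le> m" "2 \<le> m" by (auto simp: m_def)
  have "1 \<le> m * (u * \<kappa>)" using m(1) u \<kappa> by (simp add: field_simps)
  then have "(norm z)\<^sup>2 \<le> m * (u * \<kappa>) * (norm x)\<^sup>2 + m * (1 / 2) * (norm y)\<^sup>2"
    using m(2) mult_right_mono[of 1 "m * (u * \<kappa>)" "(norm x)\<^sup>2"] mult_right_mono[of 1 "m * (1 / 2)" "(norm y)\<^sup>2"]
    by (simp add: x_def y_def norm_prod_def)
  also have "\<dots> = m * (u * (\<kappa> * (norm x)\<^sup>2) + 1 / 2 * (y \<bullet> y))"
    by (simp add: power2_norm_eq_inner algebra_simps)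
  also have "\<dots> \<le> m * (u * (x \<bullet> (K *v x)) + 1 / 2 * (y \<bullet> y))"
    using m u eigenvalue_lower_bound[OF K_sym \<kappa>_le, of x]
    by (intro mult_left_mono add_mono) auto
  also have "\<dots> \<le> m * (\<gamma>\<^sup>2 * Q z z)"
  proof (rule mult_left_mono)
    have "0 \<le> 1 / 2 * ((q *\<^sub>R x + (1 / \<gamma>) *\<^sub>R y) \<bullet> (q *\<^sub>R x + (1 / \<gamma>) *\<^sub>R y))" by simp
    then have "0 \<le> \<gamma>\<^sup>2 * (1 / 2 * ((q *\<^sub>R x + (1 / \<gamma>) *\<^sub>R y) \<bullet> (q *\<^sub>R x + (1 / \<gamma>) *\<^sub>R y)))"
      by (intro mult_nonneg_nonneg) auto
    then show "u * (x \<bullet> (K *v x)) + 1 / 2 * (y \<bullet> y) \<le> \<gamma>\<^sup>2 * Q z z"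
      unfolding langevin_form_def x_def[symmetric] y_def[symmetric] q_def[symmetric] using \<gamma>
      by (simp only: distrib_left) simp
  qed (use m in auto)
  finally show ?thesis by (simp add: m_def)
qed

lemma form_nonneg: "0 \<le> Q z z"
proof -
  have "0 \<le> max (1 / (u * \<kappa>)) 2 * (\<gamma>\<^sup>2 * Q z z)" using order_trans[OF _ form_lower] by simp
  moreover have "0 < max (1 / (u * \<kappa>)) 2" by (simp add: less_max_iff_disj)
  ultimately show ?thesis using \<gamma> by (simp add: zero_le_mult_iff)
qed

lemma continuous_form [continuous_intros]:
  assumes "continuous_on S f"
  shows "continuous_on S (\<lambda>x. Q (f x) (f x))"
  unfolding langevin_form_def
  by (intro continuous_intros assms bounded_linear.continuous_on[OF matrix_vector_mul_bounded_linear])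

text \<open>The noise cancels in the difference of two schemes.\<close>

lemma euler_contraction:
  assumes t: "t \<ge> 0"
    and lim: "(\<lambda>n. euler b (t / real n) s z n) \<longlonglongrightarrow> a" "(\<lambda>n. euler b (t / real n) s z' n) \<longlonglongrightarrow> a'"
  shows "Q (a - a') (a - a') \<le> exp (- 2 * (\<gamma> * lam) * t) * Q (z - z') (z - z')"
proof -
  obtain L where L: "L-lipschitz_on UNIV b" using drift_lipschitz by blast
  \<comment> \<open>\<open>C1\<close> and \<open>C2\<close> pass from \<open>Q\<close> to the
    Euclidean norm and back, which turns the Lipschitz bound of the drift into a bound for
    \<open>Q\<close> with constant \<open>C\<close>.\<close>
  define C1 C2 C where "C1 = max (u * L_K + \<gamma>\<^sup>2) (3 / 2) / \<gamma>\<^sup>2" and "C2 = max (1 / (u * \<kappa>)) 2 * \<gamma>\<^sup>2"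
    and "C = C1 * (L\<^sup>2 * C2)"
  have C1: "C1 \<ge> 0" by (auto simp: C1_def intro!: divide_nonneg_nonneg max.coboundedI2)
  define c where "c = \<gamma> * lam"
  have drift_form: "Q (b x - b y) (b x - b y) \<le> C * Q (x - y) (x - y)" for x y
  proof -
    have "Q (b x - b y) (b x - b y) \<le> C1 * (norm (b x - b y))\<^sup>2"
      using form_upper[of "b x - b y"] \<gamma> by (simp add: C1_def field_simps)
    also have "\<dots> \<le> C1 * (L * norm (x - y))\<^sup>2"
      using lipschitz_onD[OF L, of x y] C1 by (intro mult_left_mono power_mono) (auto simp: dist_norm)
    also have "\<dots> = C1 * (L\<^sup>2 * (norm (x - y))\<^sup>2)" by (simp add: power_mult_distrib)
    also have "(norm (x - y))\<^sup>2 \<le> C2 * Q (x - y) (x - y)"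
      using form_lower[of "x - y"] by (simp only: C2_def mult.assoc)
    then have "C1 * (L\<^sup>2 * (norm (x - y))\<^sup>2) \<le> C1 * (L\<^sup>2 * (C2 * Q (x - y) (x - y)))"
      using C1 by (intro mult_left_mono) auto
    finally show ?thesis by (simp add: C_def mult_ac)
  qed
  have step: "Q (euler b h s z k - euler b h s z' k) (euler b h s z k - euler b h s z' k)
      \<le> exp (real k * (- 2 * c * h + C * h\<^sup>2)) * Q (z - z') (z - z')" if "h \<ge> 0" for h k
  proof (induction k)
    case (Suc k)
    let ?e = "euler b h s z k" and ?e' = "euler b h s z' k"
    let ?D = "?e - ?e'"
    let ?E = "b ?e - b ?e'"
    have "euler b h s z (Suc k) - euler b h s z' (Suc k) = ?D + h *\<^sub>R ?E"
      by (simp add: algebra_simps)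
    then have "Q (euler b h s z (Suc k) - euler b h s z' (Suc k)) (euler b h s z (Suc k) - euler b h s z' (Suc k))
        = Q ?D ?D + 2 * h * Q ?D ?E + h\<^sup>2 * Q ?E ?E"
      by (simp only: langevin_form_add_scaleR[OF K_sym])
    also have "\<dots> \<le> Q ?D ?D + 2 * h * (- \<gamma> * lam * Q ?D ?D) + h\<^sup>2 * (C * Q ?D ?D)"
      using that by (intro add_mono mult_left_mono form_contraction drift_form) auto
    also have "\<dots> = (1 + (- 2 * c * h + C * h\<^sup>2)) * Q ?D ?D" by (simp add: c_def algebra_simps)
    \<comment> \<open>Passing to the exponential before the induction hypothesis is inserted makes
      the multiplying factor nonnegative, whatever the size of \<open>h\<close>.\<close>
    also have "\<dots> \<le> exp (- 2 * c * h + C * h\<^sup>2) * Q ?D ?D"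
      by (intro mult_right_mono exp_ge_add_one_self form_nonneg)
    also have "\<dots> \<le> exp (- 2 * c * h + C * h\<^sup>2) * (exp (real k * (- 2 * c * h + C * h\<^sup>2)) * Q (z - z') (z - z'))"
      using Suc by (intro mult_left_mono) auto
    also have "\<dots> = exp (real (Suc k) * (- 2 * c * h + C * h\<^sup>2)) * Q (z - z') (z - z')"
      by (simp add: mult_exp_exp mult.assoc[symmetric]) (simp add: algebra_simps)
    finally show ?case .
  qed simp
  \<comment> \<open>Over \<open>n\<close> steps of length \<open>t / n\<close> the second-order
    errors add up to \<open>C * t\<^sup>2 / n\<close>, which vanishes in the limit.\<close>
  have "(\<lambda>n. exp (- 2 * c * t + C * t\<^sup>2 * inverse (real n)) * Q (z - z') (z - z'))
      \<longlonglongrightarrow> exp (- 2 * c * t + C * t\<^sup>2 * 0) * Q (z - z') (z - z')"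
    by (intro tendsto_intros LIMSEQ_inverse_real_of_nat lim_inverse_n)
  moreover have "(\<lambda>n. Q (euler b (t / real n) s z n - euler b (t / real n) s z' n)
      (euler b (t / real n) s z n - euler b (t / real n) s z' n)) \<longlonglongrightarrow> Q (a - a') (a - a')"
    by (rule continuous_on_tendsto_compose[OF continuous_form[OF continuous_on_id[of UNIV]] tendsto_diff[OF lim]]) auto
  moreover have "\<forall>n\<ge>1. Q (euler b (t / real n) s z n - euler b (t / real n) s z' n)
      (euler b (t / real n) s z n - euler b (t / real n) s z' n)
      \<le> exp (- 2 * c * t + C * t\<^sup>2 * inverse (real n)) * Q (z - z') (z - z')"
  proof (intro allI impI)
    fix n :: nat assume "1 \<le> n"
    then have "real n * (- 2 * c * (t / real n) + C * (t / real n)\<^sup>2) = - 2 * c * t + C * t\<^sup>2 * inverse (real n)"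
      by (simp add: power2_eq_square field_simps)
    then show "Q (euler b (t / real n) s z n - euler b (t / real n) s z' n)
      (euler b (t / real n) s z n - euler b (t / real n) s z' n)
      \<le> exp (- 2 * c * t + C * t\<^sup>2 * inverse (real n)) * Q (z - z') (z - z')"
      using step[of "t / real n" n] t by simp
  qed
  ultimately have "Q (a - a') (a - a') \<le> exp (- 2 * c * t + C * t\<^sup>2 * 0) * Q (z - z') (z - z')"
    by (meson LIMSEQ_le)
  then show ?thesis by (simp add: c_def)
qed

lemma euler_contraction_langevin_dist:
  assumes "t \<ge> 0" "(\<lambda>n. euler b (t / real n) s z n) \<longlonglongrightarrow> a" "(\<lambda>n. euler b (t / real n) s z' n) \<longlonglongrightarrow> a'"
  shows "langevin_dist u \<gamma> \<kappa> K a a' \<le> exp (- (\<gamma> * lam) * t) * langevin_dist u \<gamma> \<kappa> K z z'"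
proof -
  have e: "exp (- 2 * (\<gamma> * lam) * t) = (exp (- (\<gamma> * lam) * t))\<^sup>2"
    by (simp add: power2_eq_square flip: exp_add)
  have "sqrt (Q (a - a') (a - a')) \<le> sqrt ((exp (- (\<gamma> * lam) * t))\<^sup>2 * Q (z - z') (z - z'))"
    using euler_contraction[OF assms] unfolding e by (rule real_sqrt_le_mono)
  then show ?thesis
    unfolding langevin_dist_eq real_sqrt_mult by (simp only: real_sqrt_abs abs_exp_cancel)
qed

text \<open>Both norm comparisons are stated for \<open>\<gamma>\<^sup>2 * Q\<close>, so this
  scaling drops out and the product of the two constants remains under the root.\<close>

lemma euler_contraction_dist:
  assumes "t \<ge> 0" "(\<lambda>n. euler b (t / real n) s z n) \<longlonglongrightarrow> a" "(\<lambda>n. euler b (t / real n) s z' n) \<longlonglongrightarrow> a'"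
  shows "dist a a' \<le> sqrt (max (u * L_K + \<gamma>\<^sup>2) (3 / 2) * max (1 / (u * \<kappa>)) 2) * exp (- (\<gamma> * lam) * t) * dist z z'"
proof -
  define A B e where "A = max (u * L_K + \<gamma>\<^sup>2) (3 / 2)" and "B = max (1 / (u * \<kappa>)) 2"
    and "e = exp (- (\<gamma> * lam) * t)"
  have A: "0 \<le> A" unfolding A_def by (rule max.coboundedI2) simp
  have B: "0 \<le> B" unfolding B_def by (rule max.coboundedI2) simp
  have e: "exp (- 2 * (\<gamma> * lam) * t) = e\<^sup>2" unfolding e_def
    by (simp add: power2_eq_square flip: exp_add)
  have "0 \<le> e" by (simp add: e_def)
  have "(norm (a - a'))\<^sup>2 \<le> B * (\<gamma>\<^sup>2 * Q (a - a') (a - a'))" unfolding B_def by (rule form_lower)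
  also have "\<dots> \<le> B * (\<gamma>\<^sup>2 * (e\<^sup>2 * Q (z - z') (z - z')))"
    using B euler_contraction[OF assms] unfolding e by (intro mult_left_mono) auto
  also have "\<dots> = B * e\<^sup>2 * (\<gamma>\<^sup>2 * Q (z - z') (z - z'))" by (simp only: mult_ac)
  also have "\<dots> \<le> B * e\<^sup>2 * (A * (norm (z - z'))\<^sup>2)"
    unfolding A_def using B by (intro mult_left_mono form_upper) auto
  also have "\<dots> = (sqrt (A * B) * e * norm (z - z'))\<^sup>2"
    using mult_nonneg_nonneg[OF A B] by (simp add: power_mult_distrib)
  finally have "norm (a - a') \<le> sqrt (A * B) * e * norm (z - z')"
    by (rule power2_le_imp_le) (use A B \<open>0 \<le> e\<close> in auto)
  then show ?thesis by (simp add: dist_norm A_def B_def e_def)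
qed

end

section \<open>Laws of the Euler scheme and of its limit\<close>

text \<open>The indicator of a closed set is the pointwise limit of the continuous functions
  \<open>f k\<close>, and closed sets form an intersection-stable generator. This identifies two
  laws that arise as limits of equal integrals.\<close>

lemma measure_eqI_continuous:
  fixes \<mu> \<nu> :: "'a::metric_space measure"
  assumes "finite_measure \<mu>" "finite_measure \<nu>" and sets: "sets \<mu> = sets borel" "sets \<nu> = sets borel"
    and eq: "\<And>f :: 'a \<Rightarrow> real. continuous_on UNIV f \<Longrightarrow> (\<And>x. 0 \<le> f x) \<Longrightarrow> (\<And>x. f x \<le> 1) \<Longrightarrow>
      (\<integral>\<^sup>+x. ennreal (f x) \<partial>\<mu>) = (\<integral>\<^sup>+x. ennreal (f x) \<partial>\<nu>)"
  shows "\<mu> = \<nu>"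
proof -
  interpret \<mu>: finite_measure \<mu> by fact
  interpret \<nu>: finite_measure \<nu> by fact
  note [measurable_cong] = sets
  have closed_eq: "emeasure \<mu> S = emeasure \<nu> S" if S: "closed S" for S
  \<comment> \<open>\<open>infdist x {}\<close> is 0 by convention, so for the empty set the
    approximants would be constantly 1.\<close>
  proof (cases "S = {}")
    case False
    define f where "f k x = max 0 (1 - real k * infdist x S)" for k x
    have cont: "continuous_on UNIV (f k)" for k unfolding f_def by (intro continuous_intros)
    have bounds: "0 \<le> f k x" "f k x \<le> 1" for k x by (auto simp: f_def infdist_nonneg)
    have lim: "(\<lambda>k. ennreal (f k x)) \<longlonglongrightarrow> indicator S x" for x
    proof (cases "x \<in> S")
      case True
      then show ?thesis by (simp add: f_def)
    next
      case notin: False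
      then have pos: "infdist x S > 0" using S False infdist_pos_not_in_closed by blast
      have "\<forall>\<^sub>F k in sequentially. ennreal (f k x) = 0"
      proof -
        obtain N :: nat where N: "real N > 1 / infdist x S" using reals_Archimedean2 by blast
        have "f k x = 0" if "k \<ge> N" for k
        proof -
          have "real k > 1 / infdist x S" using N that by linarith
          then have "1 \<le> real k * infdist x S" using pos by (simp add: field_simps)
          then show ?thesis by (simp add: f_def)
        qed
        then show ?thesis unfolding eventually_sequentially by (intro exI[of _ N]) auto
      qed
      then show ?thesis using notin by (simp add: tendsto_eventually)
    qed
    have conv: "(\<lambda>k. \<integral>\<^sup>+x. ennreal (f k x) \<partial>\<rho>) \<longlonglongrightarrow> emeasure \<rho> S"
      if "finite_measure \<rho>" and [measurable_cong]: "sets \<rho> = sets borel" for \<rho>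
    proof -
      interpret \<rho>: finite_measure \<rho> by fact
      have [measurable]: "S \<in> sets \<rho>" using S that by auto
      have [measurable]: "f k \<in> borel_measurable \<rho>" for k
        using borel_measurable_continuous_onI[OF cont] by measurable
      have "(\<lambda>k. \<integral>\<^sup>+x. ennreal (f k x) \<partial>\<rho>) \<longlonglongrightarrow> (\<integral>\<^sup>+x. indicator S x \<partial>\<rho>)"
        by (rule nn_integral_dominated_convergence[where w = "\<lambda>_. 1"])
          (use bounds lim in \<open>auto simp: ennreal_le_1 less_top[symmetric] \<rho>.emeasure_eq_measure\<close>)
      then show ?thesis by simp
    qed
    have "(\<integral>\<^sup>+x. ennreal (f k x) \<partial>\<mu>) = (\<integral>\<^sup>+x. ennreal (f k x) \<partial>\<nu>)" for k
      by (intro eq cont bounds)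
    then show ?thesis
      using conv[OF \<open>finite_measure \<mu>\<close> sets(1)] conv[OF \<open>finite_measure \<nu>\<close> sets(2)] LIMSEQ_unique by auto
  qed simp
  show ?thesis
  proof (rule measure_eqI_generator_eq[where E = "Collect closed" and \<Omega> = UNIV and A = "\<lambda>_. UNIV"])
    show "Int_stable (Collect closed :: 'a set set)" by (auto simp: Int_stable_def)
    show "sets \<mu> = sigma_sets UNIV (Collect closed)" "sets \<nu> = sigma_sets UNIV (Collect closed)"
      unfolding sets by (simp_all add: borel_eq_closed)
  qed (auto intro: closed_eq)
qed

section \<open>Adaptedness and increments of Brownian motion\<close>

lemma brownian_motion_measurable:
  assumes "brownian_motion M F B" "t \<ge> 0"
  shows "B t \<in> borel_measurable M"
proof (rule measurable_from_subalg)
  show "subalgebra M (F t)"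
    using assms unfolding brownian_motion_def subalgebra_def
    by (auto simp: filtration.space_F)
  show "B t \<in> borel_measurable (F t)" using assms unfolding brownian_motion_def by blast
qed

lemma brownian_motion_subalgebra:
  assumes "brownian_motion M F B"
  shows "0 \<le> s \<Longrightarrow> s \<le> t \<Longrightarrow> subalgebra (F t) (F s)" "0 \<le> s \<Longrightarrow> subalgebra M (F s)"
proof -
  have "filtration (space M) F" and *: "\<And>t. t \<ge> 0 \<Longrightarrow> sets (F t) \<subseteq> sets M"
    using assms unfolding brownian_motion_def by auto
  then interpret filtration "space M" F by simp
  show "0 \<le> s \<Longrightarrow> s \<le> t \<Longrightarrow> subalgebra (F t) (F s)" "0 \<le> s \<Longrightarrow> subalgebra M (F s)"
    using sets_F_mono[of s t] * by (auto simp: subalgebra_def space_F)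
qed

definition noise_law :: "real \<Rightarrow> (real ^ 'n) measure" where
  "noise_law h = density lborel (\<lambda>x. ennreal (\<Prod>i\<in>UNIV. normal_density 0 (sqrt h) (x $ i)))"

lemma brownian_increment_law:
  fixes B :: "real \<Rightarrow> 'w \<Rightarrow> real ^ 'n"
  assumes "brownian_motion M F B" "0 \<le> s" "s < t"
  shows "distr M borel (\<lambda>w. B t w - B s w) = noise_law (t - s)"
proof -
  have "distributed M lborel (\<lambda>w. B t w - B s w)
      (\<lambda>x. ennreal (\<Prod>i\<in>UNIV. normal_density 0 (sqrt (t - s)) (x $ i)))"
    using assms unfolding brownian_motion_def by blast
  then have "distr M lborel (\<lambda>w. B t w - B s w) = noise_law (t - s)"
    unfolding noise_law_def by (rule distributed_distr_eq_density)
  moreover have "distr M borel (\<lambda>w. B t w - B s w) = distr M lborel (\<lambda>w. B t w - B s w)"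
    by (intro distr_cong) auto
  ultimately show ?thesis by simp
qed

text \<open>No Gaussian integral is computed: the given Brownian motion has an increment with this
  law.\<close>

lemma prob_space_noise_law:
  fixes B :: "real \<Rightarrow> 'w \<Rightarrow> real ^ 'n"
  assumes BM: "brownian_motion M F B" and s: "0 \<le> s" "s < t"
  shows "prob_space (noise_law (t - s) :: (real ^ 'n) measure)"
proof -
  have "prob_space M" using BM by (simp add: brownian_motion_def)
  then show ?thesis
    unfolding brownian_increment_law[OF BM s, symmetric]
    by (rule prob_space.prob_space_distr)
      (use s in \<open>auto intro!: borel_measurable_diff brownian_motion_measurable[OF BM]\<close>)
qed

text \<open>The Markov property in integrated form: the increment is independent of
  \<open>F s\<close>, so the joint law with \<open>A\<close> is a product and Fubini integrates the
  increment out.\<close>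

lemma nn_integral_brownian_increment:
  fixes B :: "real \<Rightarrow> 'w \<Rightarrow> real ^ 'n" and A :: "'w \<Rightarrow> 'a::second_countable_topology"
  assumes BM: "brownian_motion M F B" and s: "0 \<le> s" "s < t"
    and A: "A \<in> borel_measurable (F s)" and g: "g \<in> borel_measurable (borel \<Otimes>\<^sub>M borel)"
  shows "(\<integral>\<^sup>+w. g (A w, B t w - B s w) \<partial>M) = (\<integral>\<^sup>+w. (\<integral>\<^sup>+\<xi>. g (A w, \<xi>) \<partial>noise_law (t - s)) \<partial>M)"
proof -
  interpret prob_space M using BM by (simp add: brownian_motion_def)
  let ?I = "\<lambda>w. B t w - B s w"
  have [measurable]: "B t \<in> borel_measurable M" "B s \<in> borel_measurable M"
    using brownian_motion_measurable[OF BM] s by auto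
  have [measurable]: "A \<in> borel_measurable M"
    using brownian_motion_subalgebra(2)[OF BM] s A by (auto intro: measurable_from_subalg)
  note [measurable] = g
  have space: "space (F s) = space M"
    using brownian_motion_subalgebra(2)[OF BM, of s] s by (simp add: subalgebra_def)
  have ind: "indep_set (sets (F s)) (sets (vimage_algebra (space M) ?I borel))"
    using BM s unfolding brownian_motion_def by blast
  interpret N: prob_space "noise_law (t - s) :: (real ^ 'n) measure"
    by (rule prob_space_noise_law[OF BM s])
  interpret A: prob_space "distr M borel A" by (rule prob_space_distr) simp
  have [measurable_cong]: "sets (noise_law (t - s) :: (real ^ 'n) measure) = sets borel"
    by (simp add: noise_law_def)
  have joint: "distr M borel A \<Otimes>\<^sub>M noise_law (t - s) = distr M (borel \<Otimes>\<^sub>M borel) (\<lambda>w. (A w, ?I w))"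
  proof (rule pair_measure_eqI)
    fix S T assume "S \<in> sets (distr M borel A)" "T \<in> sets (noise_law (t - s) :: (real ^ 'n) measure)"
    then have [measurable]: "S \<in> sets borel" "T \<in> sets borel" by (simp_all add: noise_law_def)
    have "A -` S \<inter> space M \<in> sets (F s)" using A by (auto simp flip: space)
    moreover have "?I -` T \<inter> space M \<in> sets (vimage_algebra (space M) ?I borel)"
      by (auto simp: sets_vimage_algebra2)
    ultimately have "prob ((A -` S \<inter> space M) \<inter> (?I -` T \<inter> space M))
        = prob (A -` S \<inter> space M) * prob (?I -` T \<inter> space M)"
      using ind unfolding indep_sets2_eq by blast
    moreover have "(A -` S \<inter> space M) \<inter> (?I -` T \<inter> space M) = (\<lambda>w. (A w, ?I w)) -` (S \<times> T) \<inter> space M"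
      by auto
    ultimately show "emeasure (distr M borel A) S * emeasure (noise_law (t - s)) T
        = emeasure (distr M (borel \<Otimes>\<^sub>M borel) (\<lambda>w. (A w, ?I w))) (S \<times> T)"
      by (simp add: emeasure_distr emeasure_eq_measure ennreal_mult'' flip: brownian_increment_law[OF BM s])
  qed (fact A.sigma_finite_measure_axioms N.sigma_finite_measure_axioms
      | simp add: noise_law_def cong: sets_pair_measure_cong)+
  have "(\<integral>\<^sup>+w. g (A w, ?I w) \<partial>M) = (\<integral>\<^sup>+z. g z \<partial>distr M (borel \<Otimes>\<^sub>M borel) (\<lambda>w. (A w, ?I w)))"
    by (subst nn_integral_distr) auto
  also have "\<dots> = (\<integral>\<^sup>+x. (\<integral>\<^sup>+\<xi>. g (x, \<xi>) \<partial>noise_law (t - s)) \<partial>distr M borel A)"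
    unfolding joint[symmetric] by (rule N.nn_integral_fst[symmetric]) simp
  also have "\<dots> = (\<integral>\<^sup>+w. (\<integral>\<^sup>+\<xi>. g (A w, \<xi>) \<partial>noise_law (t - s)) \<partial>M)"
    by (subst nn_integral_distr) auto
  finally show ?thesis .
qed

section \<open>Euler schemes and flow driven by Brownian motion\<close>

abbreviation noise_path :: "real \<Rightarrow> (real \<Rightarrow> 'w \<Rightarrow> real ^ 'n) \<Rightarrow> 'w \<Rightarrow> real \<Rightarrow> (real ^ 'n) \<times> (real ^ 'n)" where
  "noise_path \<sigma> B w \<equiv> (\<lambda>r. (0, \<sigma> *\<^sub>R B r w))"

text \<open>The Markov operator of one step. Letting it act on test functions makes several steps a
  plain \<open>funpow\<close>.\<close>

definition euler_transition :: "((real ^ 'n) \<times> (real ^ 'n) \<Rightarrow> (real ^ 'n) \<times> (real ^ 'n)) \<Rightarrow> real \<Rightarrow> real \<Rightarrow>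
    ((real ^ 'n) \<times> (real ^ 'n) \<Rightarrow> ennreal) \<Rightarrow> (real ^ 'n) \<times> (real ^ 'n) \<Rightarrow> ennreal" where
  "euler_transition b \<sigma> h f z = (\<integral>\<^sup>+\<xi>. f (z + h *\<^sub>R b z + (0, \<sigma> *\<^sub>R \<xi>)) \<partial>noise_law h)"

lemma measurable_euler_transition:
  assumes [measurable]: "b \<in> borel_measurable borel" "f \<in> borel_measurable borel"
    and N: "sigma_finite_measure (noise_law h :: (real ^ 'n) measure)"
  shows "euler_transition b \<sigma> h f \<in> borel_measurable (borel :: ((real ^ 'n) \<times> (real ^ 'n)) measure)"
proof -
  interpret N: sigma_finite_measure "noise_law h :: (real ^ 'n) measure" by fact
  have [measurable_cong]: "sets (noise_law h :: (real ^ 'n) measure) = sets borel"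
    by (simp add: noise_law_def)
  show ?thesis unfolding euler_transition_def[abs_def] by measurable
qed

text \<open>Separate maps for starting point and noise cover both uses: joint measurability on a
  product space, and adaptedness, with \<open>F (real k * h)\<close> in the roles of
  \<open>N\<close> and \<open>M\<close>. For the latter, \<open>B\<close> is constrained only up to
  time \<open>real k * h\<close>.\<close>

lemma measurable_euler:
  fixes B :: "real \<Rightarrow> 'w \<Rightarrow> real ^ 'n"
  assumes [measurable]: "b \<in> borel_measurable borel" "pr \<in> borel_measurable N" "W \<in> measurable N M"
    and B: "\<And>t. 0 \<le> t \<Longrightarrow> t \<le> real k * h \<Longrightarrow> B t \<in> borel_measurable M" and h: "h \<ge> 0"
  shows "(\<lambda>x. euler b h (noise_path \<sigma> B (W x)) (pr x) k) \<in> borel_measurable N"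
  using B
proof (induction k)
  case (Suc k)
  have [measurable]: "(\<lambda>x. euler b h (noise_path \<sigma> B (W x)) (pr x) k) \<in> borel_measurable N"
    using h by (intro Suc) (auto simp: algebra_simps)
  have [measurable]: "B (real (Suc k) * h) \<in> borel_measurable M" "B (real k * h) \<in> borel_measurable M"
    using h by (auto intro!: Suc.prems mult_right_mono simp del: of_nat_Suc)
  show ?case unfolding euler.simps by measurable
qed simp

text \<open>The last step is integrated out first, conditionally on the time before it. This
  replaces \<open>f\<close> by its transition, so the induction is over all
  \<open>f\<close>.\<close>

lemma nn_integral_euler:
  fixes B :: "real \<Rightarrow> 'w \<Rightarrow> real ^ 'n"
  assumes BM: "brownian_motion M F B" and b[measurable]: "b \<in> borel_measurable borel" and h: "h > 0"
    and Z: "Z \<in> borel_measurable (F 0)" and f: "f \<in> borel_measurable borel"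
  shows "(\<integral>\<^sup>+w. f (euler b h (noise_path \<sigma> B w) (Z w) k) \<partial>M) = (\<integral>\<^sup>+w. (euler_transition b \<sigma> h ^^ k) f (Z w) \<partial>M)"
  using f
proof (induction k arbitrary: f)
  case (Suc k)
  note [measurable] = Suc.prems
  let ?e = "\<lambda>w. euler b h (noise_path \<sigma> B w) (Z w) k"
  have kh: "real (Suc k) * h - real k * h = h" by (simp add: algebra_simps)
  have N: "prob_space (noise_law h :: (real ^ 'n) measure)"
    using prob_space_noise_law[OF BM, of 0 h] h by simp
  have e: "?e \<in> borel_measurable (F (real k * h))"
  proof (rule measurable_euler[where N = "F (real k * h)" and M = "F (real k * h)"])
    show "Z \<in> borel_measurable (F (real k * h))"
      using brownian_motion_subalgebra(1)[OF BM, of 0 "real k * h"] Z h by (auto intro: measurable_from_subalg)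
    show "B t \<in> borel_measurable (F (real k * h))" if "0 \<le> t" "t \<le> real k * h" for t
      using brownian_motion_subalgebra(1)[OF BM that] BM that
      unfolding brownian_motion_def by (auto intro: measurable_from_subalg)
  qed (use h in auto)
  have "(\<integral>\<^sup>+w. f (euler b h (noise_path \<sigma> B w) (Z w) (Suc k)) \<partial>M) =
      (\<integral>\<^sup>+w. (\<lambda>(z, \<xi>). f (z + h *\<^sub>R b z + (0, \<sigma> *\<^sub>R \<xi>))) (?e w, B (real (Suc k) * h) w - B (real k * h) w) \<partial>M)"
    by (simp add: scaleR_diff_right del: of_nat_Suc)
  also have "\<dots> = (\<integral>\<^sup>+w. euler_transition b \<sigma> h f (?e w) \<partial>M)"
    using h by (subst nn_integral_brownian_increment[OF BM _ _ e])
      (auto simp: kh euler_transition_def simp del: of_nat_Suc)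
  also have "\<dots> = (\<integral>\<^sup>+w. (euler_transition b \<sigma> h ^^ k) (euler_transition b \<sigma> h f) (Z w) \<partial>M)"
    using N by (intro Suc.IH measurable_euler_transition prob_space_imp_sigma_finite) auto
  finally show ?case by (simp add: funpow_swap1)
qed simp

text \<open>The total operator \<open>lim\<close> makes this a function of every path and starting
  point; its value is meaningful only where the schemes converge.\<close>

definition euler_flow :: "('a \<Rightarrow> 'a) \<Rightarrow> real \<Rightarrow> (real \<Rightarrow> 'a) \<Rightarrow> 'a \<Rightarrow> 'a::real_normed_vector" where
  "euler_flow b t s z = lim (\<lambda>n. euler b (t / real n) s z n)"

text \<open>The quantifier over \<open>z\<close> stands inside the almost-everywhere statement:
  continuity of the path settles all starting points at once. This allows the flow from two points
  to be compared along the same \<open>w\<close>.\<close>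

lemma AE_euler_flow:
  fixes B :: "real \<Rightarrow> 'w \<Rightarrow> real ^ 'n"
  assumes BM: "brownian_motion M F B" and lip: "L-lipschitz_on UNIV b" and t: "t \<ge> 0"
  shows "AE w in M. \<forall>z. (\<lambda>n. euler b (t / real n) (noise_path \<sigma> B w) z n) \<longlonglongrightarrow> euler_flow b t (noise_path \<sigma> B w) z"
proof -
  have "AE w in M. continuous_on {0..} (\<lambda>t. B t w)" using BM by (simp add: brownian_motion_def)
  then show ?thesis
  proof eventually_elim
    case (elim w)
    then have "continuous_on {0..t} (noise_path \<sigma> B w)"
      by (intro continuous_intros continuous_on_subset[OF elim]) auto
    from euler_convergent[OF lip t this] show ?case
      by (simp add: euler_flow_def convergent_LIMSEQ_iff)
  qed
qed

lemma measurable_euler_flow: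
  fixes B :: "real \<Rightarrow> 'w \<Rightarrow> real ^ 'n"
  assumes BM: "brownian_motion M F B" and "b \<in> borel_measurable borel" "t \<ge> 0"
    "pr \<in> borel_measurable N" "W \<in> measurable N M"
  shows "(\<lambda>x. euler_flow b t (noise_path \<sigma> B (W x)) (pr x)) \<in> borel_measurable N"
  unfolding euler_flow_def using assms
  by (intro borel_measurable_lim_metric measurable_euler[where M = M]) (auto intro: brownian_motion_measurable)

text \<open>Uniqueness in law: the solution may live on another probability space than the Brownian
  motion that drives the flow.\<close>

lemma distr_euler_flow:
  fixes B :: "real \<Rightarrow> 'w \<Rightarrow> real ^ 'n" and B' :: "real \<Rightarrow> 'v \<Rightarrow> real ^ 'n"
  assumes BM: "brownian_motion M F B" and BM': "brownian_motion M' F' B'"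
    and lip: "L-lipschitz_on UNIV b" and t: "t > 0"
    and N: "prob_space N" and pr[measurable]: "pr \<in> borel_measurable N"
    and Z0: "Z0 \<in> borel_measurable (F' 0)" and law: "distr N borel pr = distr M' borel Z0"
    and Zt[measurable]: "Zt \<in> borel_measurable M'"
    and lim: "AE w in M'. (\<lambda>n. euler b (t / real n) (noise_path \<sigma> B' w) (Z0 w) n) \<longlonglongrightarrow> Zt w"
  shows "distr (N \<Otimes>\<^sub>M M) borel (\<lambda>(x, w). euler_flow b t (noise_path \<sigma> B w) (pr x)) = distr M' borel Zt"
    (is "?L = ?R")
proof -
  interpret M: prob_space M using BM by (simp add: brownian_motion_def)
  interpret M': prob_space M' using BM' by (simp add: brownian_motion_def)
  interpret N: prob_space N by fact
  interpret NM: pair_prob_space N M ..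
  have b[measurable]: "b \<in> borel_measurable borel"
    by (intro borel_measurable_continuous_onI lipschitz_on_continuous_on[OF lip])
  have Z0M[measurable]: "Z0 \<in> borel_measurable M'"
    using brownian_motion_subalgebra(2)[OF BM'] Z0 by (auto intro: measurable_from_subalg)
  \<comment> \<open>The index is shifted because \<open>t / real 0\<close> is 0, while the Gaussian
    law of an increment requires a positive step.\<close>
  let ?E = "\<lambda>n x. euler b (t / real (Suc n)) (noise_path \<sigma> B (snd x)) (pr (fst x)) (Suc n)"
  let ?E' = "\<lambda>n w. euler b (t / real (Suc n)) (noise_path \<sigma> B' w) (Z0 w) (Suc n)"
  let ?\<Phi> = "\<lambda>x. euler_flow b t (noise_path \<sigma> B (snd x)) (pr (fst x))"
  have E[measurable]: "?E n \<in> borel_measurable (N \<Otimes>\<^sub>M M)" for n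
    using t by (intro measurable_euler[where M = M] brownian_motion_measurable[OF BM]) auto
  have E'[measurable]: "?E' n \<in> borel_measurable M'" for n
    using t by (intro measurable_euler[where M = M'] brownian_motion_measurable[OF BM']) auto
  have \<Phi>[measurable]: "?\<Phi> \<in> borel_measurable (N \<Otimes>\<^sub>M M)"
    using t by (intro measurable_euler_flow[OF BM]) auto
  have AE: "AE x in N \<Otimes>\<^sub>M M. (\<lambda>n. ?E n x) \<longlonglongrightarrow> ?\<Phi> x"
  proof -
    \<comment> \<open>Passing from sections to the product requires a measurable set, and the Cauchy
      property of measurable maps defines one. Convergence to the flow is recovered from
      completeness.\<close>
    have "AE x in N \<Otimes>\<^sub>M M. Cauchy (\<lambda>n. ?E n x)"
    proof (rule NM.AE_pair_measure)
      show "{x \<in> space (N \<Otimes>\<^sub>M M). Cauchy (\<lambda>n. ?E n x)} \<in> sets (N \<Otimes>\<^sub>M M)"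
        using E by (rule sets_Collect_Cauchy)
      have "AE w in M. \<forall>z. Cauchy (\<lambda>n. euler b (t / real (Suc n)) (noise_path \<sigma> B w) z (Suc n))"
        using AE_euler_flow[OF BM lip less_imp_le[OF t], of \<sigma>]
      proof eventually_elim
        case (elim w)
        show ?case by (intro allI LIMSEQ_imp_Cauchy[OF LIMSEQ_Suc[OF elim[rule_format]]])
      qed
      then show "AE x in N. AE w in M. Cauchy (\<lambda>n. ?E n (x, w))"
        by - (rule AE_I2, erule eventually_mono, simp only: fst_conv snd_conv)
    qed
    then show ?thesis
    proof eventually_elim
      case (elim x)
      then have "convergent (\<lambda>n. euler b (t / real n) (noise_path \<sigma> B (snd x)) (pr (fst x)) n)"
        using convergent_Suc_iff[of "\<lambda>n. euler b (t / real n) (noise_path \<sigma> B (snd x)) (pr (fst x)) n"]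
        by (simp add: Cauchy_convergent_iff del: of_nat_Suc euler.simps)
      then show ?case
        unfolding euler_flow_def convergent_LIMSEQ_iff by (rule LIMSEQ_Suc)
    qed
  qed
  have "?L = distr (N \<Otimes>\<^sub>M M) borel ?\<Phi>" by (simp add: case_prod_beta')
  also have "\<dots> = ?R"
  proof (rule measure_eqI_continuous)
    show "finite_measure (distr (N \<Otimes>\<^sub>M M) borel ?\<Phi>)" by (intro NM.finite_measure_distr \<Phi>)
    show "finite_measure (distr M' borel Zt)" by (intro M'.finite_measure_distr Zt)
    fix f :: "(real ^ 'n) \<times> (real ^ 'n) \<Rightarrow> real"
    assume cont: "continuous_on UNIV f" and f0: "\<And>x. 0 \<le> f x" and f1: "\<And>x. f x \<le> 1"
    have [measurable]: "f \<in> borel_measurable borel" using cont by (rule borel_measurable_continuous_onI)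
    have "(\<lambda>n. \<integral>\<^sup>+x. ennreal (f (?E n x)) \<partial>(N \<Otimes>\<^sub>M M)) \<longlonglongrightarrow> (\<integral>\<^sup>+x. ennreal (f (?\<Phi> x)) \<partial>(N \<Otimes>\<^sub>M M))"
    proof (rule nn_integral_dominated_convergence[where w = "\<lambda>_. 1"])
      show "AE x in N \<Otimes>\<^sub>M M. (\<lambda>n. ennreal (f (?E n x))) \<longlonglongrightarrow> ennreal (f (?\<Phi> x))"
        using AE by eventually_elim (auto intro!: tendsto_ennrealI continuous_on_tendsto_compose[OF cont])
    qed (auto simp: f1 NM.emeasure_space_1 simp del: euler.simps of_nat_Suc)
    moreover have "(\<lambda>n. \<integral>\<^sup>+w. ennreal (f (?E' n w)) \<partial>M') \<longlonglongrightarrow> (\<integral>\<^sup>+w. ennreal (f (Zt w)) \<partial>M')"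
    proof (rule nn_integral_dominated_convergence[where w = "\<lambda>_. 1"])
      show "AE w in M'. (\<lambda>n. ennreal (f (?E' n w))) \<longlonglongrightarrow> ennreal (f (Zt w))"
        using lim by eventually_elim
          (intro tendsto_ennrealI continuous_on_tendsto_compose[OF cont] LIMSEQ_Suc; auto)
    qed (auto simp: f1 M'.emeasure_space_1 simp del: euler.simps of_nat_Suc)
    moreover have "(\<integral>\<^sup>+x. ennreal (f (?E n x)) \<partial>(N \<Otimes>\<^sub>M M)) = (\<integral>\<^sup>+w. ennreal (f (?E' n w)) \<partial>M')" for n
    proof -
      define h where "h = t / real (Suc n)"
      have h: "h > 0" using t by (simp add: h_def)
      let ?P = "(euler_transition b \<sigma> h ^^ Suc n) (\<lambda>x. ennreal (f x))"
      have "prob_space (noise_law h :: (real ^ 'n) measure)"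
        using prob_space_noise_law[OF BM, of 0 h] h by simp
      then have sf: "sigma_finite_measure (noise_law h :: (real ^ 'n) measure)"
        by (rule prob_space_imp_sigma_finite)
      have "(euler_transition b \<sigma> h ^^ k) (\<lambda>x. ennreal (f x)) \<in> borel_measurable borel" for k
      proof (induction k)
        case (Suc k)
        show ?case unfolding funpow.simps comp_apply by (rule measurable_euler_transition[OF b Suc sf])
      qed simp
      then have P[measurable]: "?P \<in> borel_measurable borel" .
      have "(\<integral>\<^sup>+x. ennreal (f (?E n x)) \<partial>(N \<Otimes>\<^sub>M M)) = (\<integral>\<^sup>+x. (\<integral>\<^sup>+w. ennreal (f (?E n (x, w))) \<partial>M) \<partial>N)"
        by (rule M.nn_integral_fst[symmetric]) measurable
      also have "\<dots> = (\<integral>\<^sup>+x. ?P (pr x) \<partial>N)"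
      proof (rule nn_integral_cong)
        fix x
        \<comment> \<open>For fixed \<open>x\<close> the start is a constant, hence measurable for
          \<open>F 0\<close>, and the integral of the resulting constant over \<open>M\<close> is
          that constant.\<close>
        show "(\<integral>\<^sup>+w. ennreal (f (?E n (x, w))) \<partial>M) = ?P (pr x)"
          using nn_integral_euler[OF BM b h, of "\<lambda>_. pr x" "\<lambda>x. ennreal (f x)" \<sigma> "Suc n"]
          by (simp add: M.emeasure_space_1 h_def del: euler.simps of_nat_Suc funpow.simps)
      qed
      also have "\<dots> = (\<integral>\<^sup>+z. ?P z \<partial>distr N borel pr)" using P by (subst nn_integral_distr[OF pr]) (simp_all only: measurable_distr_eq1)
      also have "\<dots> = (\<integral>\<^sup>+w. ?P (Z0 w) \<partial>M')" unfolding law using P by (subst nn_integral_distr[OF Z0M]) (simp_all only: measurable_distr_eq1)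
      also have "\<dots> = (\<integral>\<^sup>+w. ennreal (f (?E' n w)) \<partial>M')"
        unfolding h_def[symmetric] by (rule nn_integral_euler[OF BM' b h Z0, symmetric]) simp
      finally show ?thesis .
    qed
    ultimately have "(\<integral>\<^sup>+x. ennreal (f (?\<Phi> x)) \<partial>(N \<Otimes>\<^sub>M M)) = (\<integral>\<^sup>+w. ennreal (f (Zt w)) \<partial>M')"
      using LIMSEQ_unique by (simp del: euler.simps of_nat_Suc)
    then show "(\<integral>\<^sup>+x. ennreal (f x) \<partial>distr (N \<Otimes>\<^sub>M M) borel ?\<Phi>) = (\<integral>\<^sup>+x. ennreal (f x) \<partial>distr M' borel Zt)"
      by (simp add: nn_integral_distr)
  qed simp_all
  finally show ?thesis .
qed

section \<open>Wasserstein distances\<close>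

lemma ennreal_powr_mono:
  assumes "x \<le> y" "a \<ge> 0"
  shows "ennreal_powr x a \<le> ennreal_powr y a"
  using assms by (cases x; cases y) (auto simp: ennreal_powr_def top_unique intro!: ennreal_leI powr_mono2)

lemma ennreal_powr_mult:
  assumes "k > 0" "p > 0"
  shows "ennreal_powr (ennreal (k powr p) * x) (1 / p) = ennreal k * ennreal_powr x (1 / p)"
proof (cases x)
  case (real r)
  then have "ennreal (k powr p) * x = ennreal (k powr p * r)" by (simp add: ennreal_mult)
  then have "ennreal_powr (ennreal (k powr p) * x) (1 / p) = ennreal ((k powr p * r) powr (1 / p))"
    using real by (simp only:) (simp add: ennreal_powr_def del: ennreal_mult')
  also have "(k powr p * r) powr (1 / p) = k * r powr (1 / p)"
    using assms real by (simp add: powr_mult powr_powr)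
  finally show ?thesis
    using assms real by (simp add: ennreal_powr_def ennreal_mult)
next
  case top
  then show ?thesis using assms by (simp add: ennreal_powr_def ennreal_mult_top)
qed

text \<open>No optimal coupling is used: every coupling on the right yields one on the left. The
  factor is first moved over as \<open>1 / k\<close>, so that the right side is a bare
  infimum.\<close>

lemma wasserstein_le_mult:
  assumes k: "k > 0" and p: "p > 0"
    and step: "\<And>\<omega>. \<omega> \<in> couplings \<mu> \<nu> \<Longrightarrow> \<exists>\<omega>'\<in>couplings \<mu>' \<nu>'.
      (\<integral>\<^sup>+z. ennreal (d (fst z) (snd z) powr p) \<partial>\<omega>')
        \<le> ennreal (k powr p) * (\<integral>\<^sup>+z. ennreal (d' (fst z) (snd z) powr p) \<partial>\<omega>)"
  shows "wasserstein p d \<mu>' \<nu>' \<le> ennreal k * wasserstein p d' \<mu> \<nu>"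
proof -
  have inv: "ennreal (1 / k) * ennreal k = 1" "ennreal k * ennreal (1 / k) = 1"
    using k by (simp_all flip: ennreal_mult)
  have "ennreal (1 / k) * wasserstein p d \<mu>' \<nu>' \<le> wasserstein p d' \<mu> \<nu>"
    unfolding wasserstein_def[of p d' \<mu> \<nu>]
  proof (rule INF_greatest)
    fix \<omega> assume "\<omega> \<in> couplings \<mu> \<nu>"
    then obtain \<omega>' where \<omega>': "\<omega>' \<in> couplings \<mu>' \<nu>'"
      and le: "(\<integral>\<^sup>+z. ennreal (d (fst z) (snd z) powr p) \<partial>\<omega>')
        \<le> ennreal (k powr p) * (\<integral>\<^sup>+z. ennreal (d' (fst z) (snd z) powr p) \<partial>\<omega>)"
      using step by blast
    let ?c = "ennreal_powr (\<integral>\<^sup>+z. ennreal (d' (fst z) (snd z) powr p) \<partial>\<omega>) (1 / p)"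
    have "wasserstein p d \<mu>' \<nu>' \<le> ennreal_powr (\<integral>\<^sup>+z. ennreal (d (fst z) (snd z) powr p) \<partial>\<omega>') (1 / p)"
      unfolding wasserstein_def by (rule INF_lower[OF \<omega>'])
    also have "\<dots> \<le> ennreal k * ?c"
      using ennreal_powr_mono[OF le, of "1 / p"] p by (simp add: ennreal_powr_mult[OF k p])
    finally have "ennreal (1 / k) * wasserstein p d \<mu>' \<nu>' \<le> ennreal (1 / k) * (ennreal k * ?c)"
      by (rule mult_left_mono) simp
    then show "ennreal (1 / k) * wasserstein p d \<mu>' \<nu>' \<le> ?c"
      by (simp add: mult.assoc[symmetric] inv)
  qed
  then have "ennreal k * (ennreal (1 / k) * wasserstein p d \<mu>' \<nu>') \<le> ennreal k * wasserstein p d' \<mu> \<nu>"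
    by (rule mult_left_mono) simp
  then show ?thesis by (simp add: mult.assoc[symmetric] inv)
qed

section \<open>Langevin solutions and the transport of couplings\<close>

lemma langevin_solution_brownian_motion: "langevin_solution u \<gamma> V M F B X Y \<Longrightarrow> brownian_motion M F B"
  by (simp add: langevin_solution_def)

lemma langevin_solution_measurable:
  assumes "langevin_solution u \<gamma> V M F B X Y" "t \<ge> 0"
  shows "(\<lambda>w. (X t w, Y t w)) \<in> borel_measurable (F t)" "(\<lambda>w. (X t w, Y t w)) \<in> borel_measurable M"
proof -
  have "X t \<in> borel_measurable (F t)" "Y t \<in> borel_measurable (F t)"
    using assms by (auto simp: langevin_solution_def)
  then show F: "(\<lambda>w. (X t w, Y t w)) \<in> borel_measurable (F t)" by (rule borel_measurable_Pair)
  show "(\<lambda>w. (X t w, Y t w)) \<in> borel_measurable M"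
    using brownian_motion_subalgebra(2)[OF langevin_solution_brownian_motion[OF assms(1)] assms(2)] F
    by (rule measurable_from_subalg)
qed

text \<open>The integral equations for position and velocity are the two projections of one equation
  in the product space, with noise in the velocity only.\<close>

lemma AE_langevin_solution_euler:
  assumes sol: "langevin_solution u \<gamma> V M F B X Y"
    and lip: "L-lipschitz_on UNIV (langevin_drift u \<gamma> V)" and t: "t \<ge> 0"
  shows "AE w in M. (\<lambda>n. euler (langevin_drift u \<gamma> V) (t / real n) (noise_path (sqrt (2 * \<gamma> * u)) B w)
    (X 0 w, Y 0 w) n) \<longlonglongrightarrow> (X t w, Y t w)"
proof -
  have "AE w in M. continuous_on {0..} (\<lambda>t. X t w) \<and> continuous_on {0..} (\<lambda>t. Y t w)"
    "AE w in M. \<forall>t\<ge>0.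
        X t w = X 0 w + integral {0..t} (\<lambda>s. Y s w) \<and>
        Y t w = Y 0 w + integral {0..t} (\<lambda>s. - \<gamma> *\<^sub>R Y s w - u *\<^sub>R grad V (X s w))
                  + sqrt (2 * \<gamma> * u) *\<^sub>R B t w"
    using sol by (simp_all add: langevin_solution_def)
  then show ?thesis
  proof eventually_elim
    case (elim w)
    let ?b = "langevin_drift u \<gamma> V" and ?Z = "\<lambda>r. (X r w, Y r w)"
    have contZ: "continuous_on {0..t} ?Z"
      using elim(1) by (intro continuous_intros) (auto elim: continuous_on_subset)
    have "?Z r = ?Z 0 + integral {0..r} (\<lambda>r. ?b (?Z r)) + noise_path (sqrt (2 * \<gamma> * u)) B w r"
      if r: "r \<in> {0..t}" for r
    proof -
      have "continuous_on {0..r} (\<lambda>r. ?b (?Z r))"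
        using r by (intro continuous_on_compose2[OF lipschitz_on_continuous_on[OF lip]]
            continuous_on_subset[OF contZ]) auto
      then have int: "(\<lambda>r. ?b (?Z r)) integrable_on {0..r}" by (rule integrable_continuous_real)
      have "fst (integral {0..r} (\<lambda>r. ?b (?Z r))) = integral {0..r} (\<lambda>s. Y s w)"
        using integral_linear[OF int bounded_linear_fst] by (simp add: o_def langevin_drift_def)
      moreover have "snd (integral {0..r} (\<lambda>r. ?b (?Z r)))
          = integral {0..r} (\<lambda>s. - \<gamma> *\<^sub>R Y s w - u *\<^sub>R grad V (X s w))"
        using integral_linear[OF int bounded_linear_snd] by (simp add: o_def langevin_drift_def)
      ultimately show ?thesis
        using elim(2)[rule_format, of r] r by (simp add: prod_eq_iff)
    qed
    from euler_tendsto_solution[OF lip t contZ this] show ?case .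
  qed
qed

text \<open>Serves both marginals: the noise always comes from the first space, while the solution
  is taken once from the first and once from the second.\<close>

lemma distr_langevin_flow:
  assumes sol': "langevin_solution u \<gamma> V M' F' B' X' Y'" and BM: "brownian_motion M F B"
    and lip: "L-lipschitz_on UNIV (langevin_drift u \<gamma> V)" and t: "t > 0"
    and N: "prob_space N" and pr: "pr \<in> borel_measurable N"
    and law: "distr N borel pr = joint_law M' (X' 0) (Y' 0)"
  shows "distr (N \<Otimes>\<^sub>M M) borel (\<lambda>(x, w). euler_flow (langevin_drift u \<gamma> V) t (noise_path (sqrt (2 * \<gamma> * u)) B w) (pr x))
    = joint_law M' (X' t) (Y' t)"
  unfolding joint_law_def
  using t law langevin_solution_measurable[OF sol'] AE_langevin_solution_euler[OF sol' lip]
  by (intro distr_euler_flow[OF BM langevin_solution_brownian_motion[OF sol'] lip t N pr])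
    (auto simp: joint_law_def)

lemma wasserstein_langevin_le:
  fixes X Y B :: "real \<Rightarrow> 'w \<Rightarrow> real ^ 'n" and X' Y' B' :: "real \<Rightarrow> 'v \<Rightarrow> real ^ 'n"
  assumes sol: "langevin_solution u \<gamma> V M F B X Y" and sol': "langevin_solution u \<gamma> V M' F' B' X' Y'"
    and lip: "L-lipschitz_on UNIV (langevin_drift u \<gamma> V)" and t: "t > 0" and k: "k > 0" and p: "p > 0"
    and d[measurable]: "(\<lambda>z. d (fst z) (snd z)) \<in> borel_measurable borel"
    and d'[measurable]: "(\<lambda>z. d' (fst z) (snd z)) \<in> borel_measurable borel"
    and nonneg: "\<And>x y. 0 \<le> d x y" "\<And>x y. 0 \<le> d' x y"
    and le: "\<And>s z z' a a'. (\<lambda>n. euler (langevin_drift u \<gamma> V) (t / real n) s z n) \<longlonglongrightarrow> a \<Longrightarrow>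
      (\<lambda>n. euler (langevin_drift u \<gamma> V) (t / real n) s z' n) \<longlonglongrightarrow> a' \<Longrightarrow> d a a' \<le> k * d' z z'"
  shows "wasserstein p d (joint_law M (X t) (Y t)) (joint_law M' (X' t) (Y' t))
    \<le> ennreal k * wasserstein p d' (joint_law M (X 0) (Y 0)) (joint_law M' (X' 0) (Y' 0))"
proof (rule wasserstein_le_mult[OF k p])
  let ?law = "joint_law M (X 0) (Y 0)" and ?law' = "joint_law M' (X' 0) (Y' 0)"
  fix \<omega> assume \<omega>: "\<omega> \<in> couplings ?law ?law'"
  note BM = langevin_solution_brownian_motion[OF sol]
  interpret M: prob_space M using BM by (simp add: brownian_motion_def)
  have [measurable_cong]: "sets \<omega> = sets (borel \<Otimes>\<^sub>M borel)"
    using \<omega> unfolding couplings_def joint_law_def by (auto cong: sets_pair_measure_cong)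
  have "distr \<omega> ?law fst = ?law" "distr \<omega> ?law' snd = ?law'"
    using \<omega> by (auto simp: couplings_def)
  moreover have "distr \<omega> ?law fst = distr \<omega> borel fst" "distr \<omega> ?law' snd = distr \<omega> borel snd"
    by (auto intro!: distr_cong simp: joint_law_def)
  \<comment> \<open>The target of \<open>distr\<close> matters only through its sigma-algebra, so
    \<open>borel\<close> may replace the marginals that \<open>couplings\<close> puts there.\<close>
  ultimately have marg: "distr \<omega> borel fst = ?law" "distr \<omega> borel snd = ?law'" by auto
  have "prob_space ?law"
    unfolding joint_law_def using langevin_solution_measurable(2)[OF sol, of 0] by (intro M.prob_space_distr) simp
  then have "prob_space \<omega>" unfolding marg(1)[symmetric] by (rule prob_space_distrD[rotated]) simp
  then interpret \<omega>: prob_space \<omega> .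
  let ?b = "langevin_drift u \<gamma> V"
  have b[measurable]: "?b \<in> borel_measurable borel"
    by (intro borel_measurable_continuous_onI lipschitz_on_continuous_on[OF lip])
  define \<Phi> where "\<Phi> z w = euler_flow ?b t (noise_path (sqrt (2 * \<gamma> * u)) B w) z" for z w
  have [measurable]: "(\<lambda>x. \<Phi> (pr x) (snd x)) \<in> borel_measurable (\<omega> \<Otimes>\<^sub>M M)"
    if "pr \<in> borel_measurable (\<omega> \<Otimes>\<^sub>M M)" for pr
    unfolding \<Phi>_def using that t by (intro measurable_euler_flow[OF BM b]) auto
  \<comment> \<open>A synchronous coupling: the product with \<open>M\<close> makes the noise
    independent of the starting pair, and both components share the same \<open>w\<close>.\<close>
  define \<omega>' where "\<omega>' = distr (\<omega> \<Otimes>\<^sub>M M) (borel \<Otimes>\<^sub>M borel) (\<lambda>x. (\<Phi> (fst (fst x)) (snd x), \<Phi> (snd (fst x)) (snd x)))"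
  have "distr \<omega>' (joint_law M (X t) (Y t)) fst = distr \<omega>' borel fst"
    "distr \<omega>' (joint_law M' (X' t) (Y' t)) snd = distr \<omega>' borel snd"
    by (auto intro!: distr_cong simp: joint_law_def)
  moreover have "distr \<omega>' borel fst = distr (\<omega> \<Otimes>\<^sub>M M) borel (\<lambda>(x, w). \<Phi> (fst x) w)"
    "distr \<omega>' borel snd = distr (\<omega> \<Otimes>\<^sub>M M) borel (\<lambda>(x, w). \<Phi> (snd x) w)"
    unfolding \<omega>'_def by (subst distr_distr; auto simp: o_def case_prod_beta')+
  moreover have "distr (\<omega> \<Otimes>\<^sub>M M) borel (\<lambda>(x, w). \<Phi> (fst x) w) = joint_law M (X t) (Y t)"
    "distr (\<omega> \<Otimes>\<^sub>M M) borel (\<lambda>(x, w). \<Phi> (snd x) w) = joint_law M' (X' t) (Y' t)"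
    unfolding \<Phi>_def
    by (rule distr_langevin_flow[OF sol BM lip t \<omega>.prob_space_axioms _ marg(1)]
        distr_langevin_flow[OF sol' BM lip t \<omega>.prob_space_axioms _ marg(2)]; simp)+
  moreover have "sets \<omega>' = sets (joint_law M (X t) (Y t) \<Otimes>\<^sub>M joint_law M' (X' t) (Y' t))"
    by (auto simp: \<omega>'_def joint_law_def cong: sets_pair_measure_cong)
  ultimately have "\<omega>' \<in> couplings (joint_law M (X t) (Y t)) (joint_law M' (X' t) (Y' t))"
    by (simp add: couplings_def)
  moreover have "(\<integral>\<^sup>+z. ennreal (d (fst z) (snd z) powr p) \<partial>\<omega>')
      \<le> ennreal (k powr p) * (\<integral>\<^sup>+z. ennreal (d' (fst z) (snd z) powr p) \<partial>\<omega>)"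
  proof -
    have [measurable]: "(\<lambda>z. d (fst z) (snd z)) \<in> borel_measurable (borel \<Otimes>\<^sub>M borel)"
      "(\<lambda>z. d' (fst z) (snd z)) \<in> borel_measurable (borel \<Otimes>\<^sub>M borel)"
      using d d' by (simp_all add: borel_prod)
    have dm[measurable]: "(\<lambda>x. d (\<Phi> (fst (fst x)) (snd x)) (\<Phi> (snd (fst x)) (snd x))) \<in> borel_measurable (\<omega> \<Otimes>\<^sub>M M)"
      using measurable_compose[of "\<lambda>x. (\<Phi> (fst (fst x)) (snd x), \<Phi> (snd (fst x)) (snd x))" "\<omega> \<Otimes>\<^sub>M M"
          "borel \<Otimes>\<^sub>M borel" "\<lambda>z. d (fst z) (snd z)" borel] by simp
    have "AE w in M. \<forall>z z'. d (\<Phi> z w) (\<Phi> z' w) \<le> k * d' z z'"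
      using AE_euler_flow[OF BM lip less_imp_le[OF t], of "sqrt (2 * \<gamma> * u)"]
      unfolding \<Phi>_def by eventually_elim (intro allI le, auto)
    then have AE: "AE w in M. ennreal (d (\<Phi> z w) (\<Phi> z' w) powr p) \<le> ennreal (k powr p) * ennreal (d' z z' powr p)" for z z'
    proof eventually_elim
      case (elim w)
      have "d (\<Phi> z w) (\<Phi> z' w) powr p \<le> (k * d' z z') powr p"
        using elim[rule_format, of z z'] nonneg(1) p by (intro powr_mono2) simp_all
      also have "\<dots> = k powr p * d' z z' powr p" by (rule powr_mult)
      finally show ?case by (simp flip: ennreal_mult)
    qed
    have "(\<integral>\<^sup>+z. ennreal (d (fst z) (snd z) powr p) \<partial>\<omega>')
        = (\<integral>\<^sup>+x. ennreal (d (\<Phi> (fst (fst x)) (snd x)) (\<Phi> (snd (fst x)) (snd x)) powr p) \<partial>(\<omega> \<Otimes>\<^sub>M M))"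
      unfolding \<omega>'_def by (subst nn_integral_distr) auto
    also have "\<dots> = (\<integral>\<^sup>+z. (\<integral>\<^sup>+w. ennreal (d (\<Phi> (fst z) w) (\<Phi> (snd z) w) powr p) \<partial>M) \<partial>\<omega>)"
      by (subst M.nn_integral_fst[symmetric]) auto
    also have "\<dots> \<le> (\<integral>\<^sup>+z. (\<integral>\<^sup>+w. ennreal (k powr p) * ennreal (d' (fst z) (snd z) powr p) \<partial>M) \<partial>\<omega>)"
      by (intro nn_integral_mono nn_integral_mono_AE AE)
    also have "\<dots> = (\<integral>\<^sup>+z. ennreal (k powr p) * ennreal (d' (fst z) (snd z) powr p) \<partial>\<omega>)"
      by (simp add: M.emeasure_space_1)
    also have "\<dots> = ennreal (k powr p) * (\<integral>\<^sup>+z. ennreal (d' (fst z) (snd z) powr p) \<partial>\<omega>)"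
      by (rule nn_integral_cmult) measurable
    finally show ?thesis .
  qed
  ultimately show "\<exists>\<omega>'\<in>couplings (joint_law M (X t) (Y t)) (joint_law M' (X' t) (Y' t)).
      (\<integral>\<^sup>+z. ennreal (d (fst z) (snd z) powr p) \<partial>\<omega>')
        \<le> ennreal (k powr p) * (\<integral>\<^sup>+z. ennreal (d' (fst z) (snd z) powr p) \<partial>\<omega>)" by blast
qed

theorem theorem1:
  fixes u \<gamma> \<kappa> L_K L_G c C p :: real
    and K :: "real ^ 'd ^ 'd"
    and V G :: "real ^ 'd \<Rightarrow> real"
    and M :: "'w measure" and F :: "real \<Rightarrow> 'w measure" and B X Y :: "real \<Rightarrow> 'w \<Rightarrow> real ^ 'd"
    and M' :: "'v measure" and F' :: "real \<Rightarrow> 'v measure" and B' X' Y' :: "real \<Rightarrow> 'v \<Rightarrow> real ^ 'd"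
    and \<mu> \<nu> :: "real \<Rightarrow> ((real ^ 'd) \<times> (real ^ 'd)) measure"
  assumes "u > 0" and "\<gamma> > 0"
    and "C2 V"
    and "\<And>x. V x = 1 / 2 * (x \<bullet> (K *v x)) + G x"
    and "positive_definite K"
    and "\<kappa> \<in> eigenvalues K" and "\<And>a. a \<in> eigenvalues K \<Longrightarrow> \<kappa> \<le> a" and "\<kappa> > 0"
    and "L_K \<in> eigenvalues K" and "\<And>a. a \<in> eigenvalues K \<Longrightarrow> a \<le> L_K"
    and "convex_on UNIV G"
    and "L_G-lipschitz_on UNIV (grad G)"
    and "L_G * u / \<gamma>\<^sup>2 \<le> 3 / 4"
    and "langevin_solution u \<gamma> V M F B X Y"
    and "langevin_solution u \<gamma> V M' F' B' X' Y'"
    and "\<And>t. t \<ge> 0 \<Longrightarrow> \<mu> t = joint_law M (X t) (Y t)"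
    and "\<And>t. t \<ge> 0 \<Longrightarrow> \<nu> t = joint_law M' (X' t) (Y' t)"
    and "c = \<gamma> * langevin_lambda u \<gamma> \<kappa>"
    and "C = sqrt (max (u * L_K + \<gamma>\<^sup>2) (3 / 2) * max (1 / (u * \<kappa>)) 2)"
    and "1 \<le> p"
  shows "c = min (\<gamma> / 8) (\<kappa> * u / \<gamma> / 2) \<and>
    (\<forall>t\<ge>0.
      wasserstein p (langevin_dist u \<gamma> \<kappa> K) (\<mu> t) (\<nu> t)
        \<le> ennreal (exp (- c * t)) * wasserstein p (langevin_dist u \<gamma> \<kappa> K) (\<mu> 0) (\<nu> 0) \<and>
      wasserstein p dist (\<mu> t) (\<nu> t) \<le> ennreal (C * exp (- c * t)) * wasserstein p dist (\<mu> 0) (\<nu> 0))"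
proof -
  interpret langevin_potential u \<gamma> \<kappa> L_K L_G K V G
    by unfold_locales (use assms in auto)
  obtain L where L: "L-lipschitz_on UNIV (langevin_drift u \<gamma> V)" using drift_lipschitz by blast
  have "c = min (\<gamma> * (1 / 8)) (\<gamma> * (\<kappa> * u / \<gamma>\<^sup>2 / 2))"
    unfolding assms(18) langevin_lambda_def using \<open>\<gamma> > 0\<close> by (intro min_mult_distrib_left[THEN trans]) simp
  then have c: "c = min (\<gamma> / 8) (\<kappa> * u / \<gamma> / 2)"
    using \<open>\<gamma> > 0\<close> by (simp add: power2_eq_square)
  \<comment> \<open>Both maxima exceed 1 through their constant entries 3/2 and 2.\<close>
  have "1 * 1 \<le> max (u * L_K + \<gamma>\<^sup>2) (3 / 2) * max (1 / (u * \<kappa>)) 2"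
    by (intro mult_mono max.coboundedI2) (auto intro: max.coboundedI2)
  then have C: "1 \<le> C" unfolding assms(19) by simp
  have meas: "(\<lambda>z. langevin_dist u \<gamma> \<kappa> K (fst z) (snd z)) \<in> borel_measurable borel"
    unfolding langevin_dist_eq by (intro borel_measurable_continuous_onI continuous_intros)
  have meas_dist: "(\<lambda>z :: ((real ^ 'd) \<times> (real ^ 'd)) \<times> ((real ^ 'd) \<times> (real ^ 'd)). dist (fst z) (snd z)) \<in> borel_measurable borel"
    by (intro borel_measurable_continuous_onI continuous_intros)
  have "wasserstein p (langevin_dist u \<gamma> \<kappa> K) (\<mu> t) (\<nu> t)
        \<le> ennreal (exp (- c * t)) * wasserstein p (langevin_dist u \<gamma> \<kappa> K) (\<mu> 0) (\<nu> 0) \<and>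
      wasserstein p dist (\<mu> t) (\<nu> t) \<le> ennreal (C * exp (- c * t)) * wasserstein p dist (\<mu> 0) (\<nu> 0)"
    if "t \<ge> 0" for t
  \<comment> \<open>The Gaussian transition requires positive steps, so time 0 is separate: the
    first estimate becomes an equality, and the second uses \<open>1 \<le> C\<close>.\<close>
  proof (cases "t = 0")
    case True
    have "1 * wasserstein p dist (\<mu> 0) (\<nu> 0) \<le> ennreal C * wasserstein p dist (\<mu> 0) (\<nu> 0)"
      using C by (intro mult_right_mono) auto
    then show ?thesis using True by simp
  next
    case False
    then have t: "t > 0" using that by simp
    note W = wasserstein_langevin_le[OF assms(14,15) L t]
    have "wasserstein p (langevin_dist u \<gamma> \<kappa> K) (\<mu> t) (\<nu> t)
        \<le> ennreal (exp (- c * t)) * wasserstein p (langevin_dist u \<gamma> \<kappa> K) (\<mu> 0) (\<nu> 0)"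
      unfolding assms(16)[OF that] assms(17)[OF that] assms(16,17)[OF order_refl]
      using \<open>1 \<le> p\<close> euler_contraction_langevin_dist[OF that]
      by (intro W meas) (auto simp: assms(18) langevin_dist_eq form_nonneg)
    moreover have "wasserstein p dist (\<mu> t) (\<nu> t) \<le> ennreal (C * exp (- c * t)) * wasserstein p dist (\<mu> 0) (\<nu> 0)"
      unfolding assms(16)[OF that] assms(17)[OF that] assms(16,17)[OF order_refl]
      using \<open>1 \<le> p\<close> C euler_contraction_dist[OF that]
      by (intro W meas_dist) (auto simp: assms(18,19))
    ultimately show ?thesis by blast
  qed
  with c show ?thesis by blast
qed

end
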